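(* Let $\alpha\in(0,1)$, let $\Lambda\subset[p]$, and suppose $n-|\tau_0|>4$. For any finite $n$ and $p$ and any (arbitrarily small) $\delta>0$, there exists a constant $\gamma_\delta\in(0,1)$ such that, when $$\lambda\in\Big[4n\gamma_\delta^{1/2}\Big\{2+2(|\tau_0|+1)\frac{\log(p/2)}{n}\Big\}\sigma_0^2,\ \frac{n\gamma_\delta^{1/4}}{6}C_{\min}\Big],$$ the confidence set $\Gamma_\alpha^{\beta_\Lambda}$ satisfies $$\mathbb P_{(\mathcal U^d,Y)}\{\beta_{0,\Lambda}\in\Gamma_\alpha^{\beta_\Lambda}(Y)\}\ge\alpha-\delta-o(e^{-c_1d})\quad(d\to\infty)$$ for some $c_1>0$. Further, $\mathbb P_{Y|\mathcal U^d}\{\beta_{0,\Lambda}\in\Gamma_\alpha^{\beta_\Lambda}(Y)\}\ge\alpha-\delta-o_p(e^{-c_1d})$.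
   Context: Setting. $n,p$ are positive integers and $X\in\mathbb R^{n\times p}$ is a fixed matrix. For $\tau\subset[p]=\{1,\dots,p\}$ (a "model"), $X_\tau$ is the submatrix of the columns of $X$ indexed by $\tau$, $|\tau|$ is the cardinality, and $H_\tau$ is the orthogonal projection matrix onto the column span of $X_\tau$. The data are $Y=X_{\tau_0}\beta_0+\sigma_0U$, where $\tau_0\subset[p]$ (nonempty), $\beta_0\in\mathbb R^{|\tau_0|}$, $\sigma_0>0$ are fixed and $U\sim N(0,I_n)$. $\beta_0^{full}\in\mathbb R^p$ equals $\beta_0$ on $\tau_0$ and $0$ off $\tau_0$, and $\beta_{0,\Lambda}$ is its subvector indexed by $\Lambda$. Identifiability: $\tau_0$ is the unique model of smallest cardinality in $\{\tau\subset[p]: X_\tau\beta_\tau=X_{\tau_0}\beta_0\text{ for some }\beta_\tau\}$. Define $$C_{\min}=\min_{\tau\ne\tau_0,\ |\tau|\le|\tau_0|}\ \min_{\beta_\tau\in\mathbb R^{|\tau|}}\ \frac{\|X_{\tau_0}\beta_0-X_\tau\beta_\tau\|_2^2}{n\max(|\tau_0\setminus\tau|,1)}>0.$$ Candidate set. $\mathcal U^d=(U_1^*,\dots,U_d^* )$ are i.i.d. $N(0,I_n)$, independent of $U$. For $\lambda>0$, $\hat\tau_b=\arg\min_{\tau}\min_{\beta_\tau\in\mathbb R^{|\tau|},\sigma\in\mathbb R}\{\|Y-X_\tau\beta_\tau-\sigma U_b^*\|_2^2+\lambda|\tau|\}$ (fixed tie-breaking rule) and $S^{(d)}=\{\hat\tau_b:b=1,\dots,d\}$.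 Confidence set. Let $O_{\tau,\Lambda}$ be the orthogonal projection matrix onto the column span of $(I-H_{\tau\setminus\Lambda})X_{\Lambda\cap\tau}$. For $y\in\mathbb R^n$, $\beta_\Lambda=(\beta_i)_{i\in\Lambda}$ and a model $\tau$, let $r=y-X_\Lambda\beta_\Lambda$ and $$\tilde T(y,(\beta_\Lambda,\tau))=\begin{cases}\dfrac{r^\top O_{\tau,\Lambda}r/|\Lambda\cap\tau|}{r^\top(I-H_\tau)r/(n-|\tau|)}&\text{if }\Lambda\cap\tau\ne\emptyset\text{ and }\beta_i=0\ \forall i\in\Lambda\setminus\tau,\\ \infty&\text{if }\beta_i\ne0\text{ for some }i\in\Lambda\setminus\tau,\\ 0&\text{if }\Lambda\cap\tau=\emptyset\text{ and }\beta_i=0\ \forall i\in\Lambda.\end{cases}$$ Let $B_\alpha(\beta_\Lambda,\tau)=[0,F^{-1}_{|\Lambda\cap\tau|,\,n-|\tau|}(\alpha)]$, where $F^{-1}_{k,m}$ is the quantile function of the $F$ distribution with $(k,m)$ degrees of freedom (when $\Lambda\cap\tau=\emptyset$, take $\{0\}$; any fixed convention may be used if $|\tau|\ge n$). Then $$\Gamma_\alpha^{\beta_\Lambda}(y)=\bigcup_{\tau\in S^{(d)}}\{\beta_\Lambda:\tilde T(y,(\beta_\Lambda,\tau))\in B_\alpha(\beta_\Lambda,\tau)\}.$$ $\mathbb P_{(\mathcal U^d,Y)}$ is the joint probability over $U$ and $\mathcal U^d$; $\mathbb P_{Y|\mathcal U^d}$ is the conditional probability given $\mathcal U^d$, and $o_p$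 is with respect to $\mathcal U^d$ as $d\to\infty$. *)

theory Defs
  imports "HOL-Probability.Probability" "HOL-Library.Landau_Symbols"
begin

section \<open>Linear model\<close>

text \<open>The design matrix is \<open>X :: real^'p^'n\<close>, so \<open>n = CARD('n)\<close> and \<open>p = CARD('p)\<close>, and a model
  is a set \<open>\<tau> :: 'p set\<close>. The coefficient vector of a model is a function on \<open>'p\<close> of which only
  the values on \<open>\<tau>\<close> are ever used.\<close>

definition model_mult :: "real^'p^'n \<Rightarrow> 'p set \<Rightarrow> ('p \<Rightarrow> real) \<Rightarrow> real^'n" where
  "model_mult X \<tau> \<beta> = (\<Sum>i\<in>\<tau>. \<beta> i *\<^sub>R column i X)"

definition full_coeff :: "'p set \<Rightarrow> ('p \<Rightarrow> real) \<Rightarrow> 'p \<Rightarrow> real" where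
  "full_coeff \<tau> \<beta> i = (if i \<in> \<tau> then \<beta> i else 0)"

definition response :: "real^'p^'n \<Rightarrow> 'p set \<Rightarrow> ('p \<Rightarrow> real) \<Rightarrow> real \<Rightarrow> real^'n \<Rightarrow> real^'n" where
  "response X \<tau>\<^sub>0 \<beta>\<^sub>0 \<sigma>\<^sub>0 u = model_mult X \<tau>\<^sub>0 \<beta>\<^sub>0 + \<sigma>\<^sub>0 *\<^sub>R u"

definition identifiable :: "real^'p^'n \<Rightarrow> 'p set \<Rightarrow> ('p \<Rightarrow> real) \<Rightarrow> bool" where
  "identifiable X \<tau>\<^sub>0 \<beta>\<^sub>0 \<longleftrightarrow>
     (\<forall>\<tau>. is_arg_min card (\<lambda>\<tau>. \<exists>\<beta>. model_mult X \<tau> \<beta> = model_mult X \<tau>\<^sub>0 \<beta>\<^sub>0) \<tau> \<longleftrightarrow> \<tau> = \<tau>\<^sub>0)"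

text \<open>Least-squares minima are attained (distance to a subspace), so they are written as infima.\<close>

definition C_min :: "real^'p^'n \<Rightarrow> 'p set \<Rightarrow> ('p \<Rightarrow> real) \<Rightarrow> real" where
  "C_min X \<tau>\<^sub>0 \<beta>\<^sub>0 =
     Min ((\<lambda>\<tau>. INF \<beta>. (norm (model_mult X \<tau>\<^sub>0 \<beta>\<^sub>0 - model_mult X \<tau> \<beta>))\<^sup>2 /
                        (real CARD('n) * real (max (card (\<tau>\<^sub>0 - \<tau>)) 1)))
          ` {\<tau>. \<tau> \<noteq> \<tau>\<^sub>0 \<and> card \<tau> \<le> card \<tau>\<^sub>0})"

lemma C_min_pos:
  fixes X :: "real^'p^'n"
  assumes "identifiable X \<tau>\<^sub>0 \<beta>\<^sub>0" and "\<tau>\<^sub>0 \<noteq> {}"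
  shows "C_min X \<tau>\<^sub>0 \<beta>\<^sub>0 > 0"
proof -
  let ?m = "model_mult X \<tau>\<^sub>0 \<beta>\<^sub>0"
  let ?c = "\<lambda>\<tau>. real CARD('n) * real (max (card (\<tau>\<^sub>0 - \<tau>)) 1)"
  let ?T = "{\<tau>. \<tau> \<noteq> \<tau>\<^sub>0 \<and> card \<tau> \<le> card \<tau>\<^sub>0}"
  have "(INF \<beta>. (norm (?m - model_mult X \<tau> \<beta>))\<^sup>2 / ?c \<tau>) > 0" if \<tau>: "\<tau> \<in> ?T" for \<tau>
  proof -
    let ?V = "span ((\<lambda>i. column i X) ` \<tau>)"
    have V: "v \<in> ?V \<longleftrightarrow> (\<exists>\<beta>. v = model_mult X \<tau> \<beta>)" for v
    proof
      assume "v \<in> ?V"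
      then show "\<exists>\<beta>. v = model_mult X \<tau> \<beta>"
      proof (induction rule: span_induct_alt)
        case base
        show ?case by (rule exI[of _ "\<lambda>_. 0"]) (simp add: model_mult_def)
      next
        case (step c x y)
        then obtain i \<beta> where i: "i \<in> \<tau>" "x = column i X" "y = model_mult X \<tau> \<beta>" by auto
        have "c *\<^sub>R x + y = model_mult X \<tau> (\<lambda>j. (if j = i then c else 0) + \<beta> j)"
          using i by (simp add: model_mult_def scaleR_left_distrib sum.distrib if_distrib
              [where f = "\<lambda>c. c *\<^sub>R _"] sum.delta cong: if_cong)
        then show ?case by blast
      qed
    next
      assume "\<exists>\<beta>. v = model_mult X \<tau> \<beta>"
      then show "v \<in> ?V"
        by (auto simp: model_mult_def intro!: span_sum span_scale intro: span_base)
    qed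
    have arg: "is_arg_min card (\<lambda>\<tau>. \<exists>\<beta>. model_mult X \<tau> \<beta> = ?m) \<tau>' \<longleftrightarrow> \<tau>' = \<tau>\<^sub>0" for \<tau>'
      using assms(1) by (auto simp: identifiable_def)
    have "?m \<notin> ?V"
    proof
      assume "?m \<in> ?V"
      then have ex: "\<exists>\<beta>. model_mult X \<tau> \<beta> = ?m" using V[of ?m] by metis
      have min0: "\<not> card \<tau>' < card \<tau>\<^sub>0" if "\<exists>\<beta>. model_mult X \<tau>' \<beta> = ?m" for \<tau>'
        using arg[of \<tau>\<^sub>0] that unfolding is_arg_min_def by blast
      have "\<not> card \<tau>' < card \<tau>" if "\<exists>\<beta>. model_mult X \<tau>' \<beta> = ?m" for \<tau>'
        using min0[OF that] \<tau> by simp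
      with ex have "\<tau> = \<tau>\<^sub>0"
        using arg[of \<tau>] unfolding is_arg_min_def by blast
      with \<tau> show False by simp
    qed
    then have d: "infdist ?m ?V > 0"
      using in_closed_iff_infdist_zero[of ?V ?m] closed_subspace[OF subspace_span]
        span_zero infdist_nonneg[of ?m ?V] by (metis empty_iff order_le_less)
    have c: "?c \<tau> > 0" by simp
    have "(infdist ?m ?V)\<^sup>2 / ?c \<tau> \<le> (INF \<beta>. (norm (?m - model_mult X \<tau> \<beta>))\<^sup>2 / ?c \<tau>)"
    proof (rule cINF_greatest)
      fix \<beta>
      have "infdist ?m ?V \<le> norm (?m - model_mult X \<tau> \<beta>)"
        using V infdist_le[of "model_mult X \<tau> \<beta>" ?V ?m] by (auto simp: dist_norm)
      then show "(infdist ?m ?V)\<^sup>2 / ?c \<tau> \<le> (norm (?m - model_mult X \<tau> \<beta>))\<^sup>2 / ?c \<tau>"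
        using d c by (intro divide_right_mono power_mono) auto
    qed simp
    moreover have "(infdist ?m ?V)\<^sup>2 / ?c \<tau> > 0" using d c by (intro divide_pos_pos) auto
    ultimately show ?thesis by linarith
  qed
  moreover have "{} \<in> ?T" using assms(2) by simp
  then have "?T \<noteq> {}" by blast
  moreover have "finite ?T" by simp
  ultimately show ?thesis
    unfolding C_min_def by (subst Min_gr_iff) auto
qed

definition std_normal_vec_density :: "real^'n \<Rightarrow> real" where
  "std_normal_vec_density u = (\<Prod>i\<in>UNIV. std_normal_density (u $ i))"


section \<open>Candidate set\<close>

definition penalized_loss :: "real^'p^'n \<Rightarrow> real \<Rightarrow> real^'n \<Rightarrow> real^'n \<Rightarrow> 'p set \<Rightarrow> real" where
  "penalized_loss X lam y u \<tau> =
     (INF (\<beta>, \<sigma>). (norm (y - model_mult X \<tau> \<beta> - \<sigma> *\<^sub>R u))\<^sup>2 + lam * real (card \<tau>))"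

text \<open>\<open>tie\<close> is the tie-breaking rule: it selects a model from the set of all minimizers.\<close>

definition tau_hat :: "('p set set \<Rightarrow> 'p set) \<Rightarrow> real^'p^'n \<Rightarrow> real \<Rightarrow> real^'n \<Rightarrow> real^'n \<Rightarrow> 'p set" where
  "tau_hat tie X lam y u = tie {\<tau>. is_arg_min (penalized_loss X lam y u) (\<lambda>_. True) \<tau>}"

definition cand_set ::
    "('p set set \<Rightarrow> 'p set) \<Rightarrow> real^'p^'n \<Rightarrow> real \<Rightarrow> real^'n \<Rightarrow> (nat \<Rightarrow> real^'n) \<Rightarrow> nat \<Rightarrow> 'p set set" where
  "cand_set tie X lam y us d = (\<lambda>b. tau_hat tie X lam y (us b)) ` {..<d}"


section \<open>\<open>F\<close> distribution\<close>

definition chi_square_dist :: "nat \<Rightarrow> real measure" where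
  "chi_square_dist k =
     distr (\<Pi>\<^sub>M i\<in>{..<k}. std_normal_distribution) borel (\<lambda>z. \<Sum>i<k. (z i)\<^sup>2)"

definition F_dist :: "nat \<Rightarrow> nat \<Rightarrow> real measure" where
  "F_dist k m =
     distr (chi_square_dist k \<Otimes>\<^sub>M chi_square_dist m) borel
       (\<lambda>(v, w). (v / real k) / (w / real m))"

definition F_quantile :: "nat \<Rightarrow> nat \<Rightarrow> real \<Rightarrow> real" where
  "F_quantile k m \<alpha> = Inf {x. \<alpha> \<le> cdf (F_dist k m) x}"


section \<open>Confidence set\<close>

definition orth_proj_mat :: "(real^'n) set \<Rightarrow> real^'n^'n" where
  "orth_proj_mat S = (THE P. \<forall>x. P *v x \<in> S \<and> (\<forall>s\<in>S. (x - P *v x) \<bullet> s = 0))"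

lemma orth_proj_mat_unique:
  fixes S :: "(real^'n) set"
  assumes "subspace S"
  shows "\<exists>!P. \<forall>x. P *v x \<in> S \<and> (\<forall>s\<in>S. (x - P *v x) \<bullet> s = 0)"
proof -
  have uniq: "a = b"
    if "a \<in> S" "b \<in> S" "\<forall>s\<in>S. (x - a) \<bullet> s = 0" "\<forall>s\<in>S. (x - b) \<bullet> s = 0" for x a b :: "real^'n"
  proof -
    have "a - b \<in> S" using that assms by (simp add: subspace_diff)
    then have "(x - b) \<bullet> (a - b) - (x - a) \<bullet> (a - b) = 0" using that by simp
    then have "(a - b) \<bullet> (a - b) = 0" by (simp add: inner_diff_left inner_diff_right)
    then show ?thesis by simp
  qed
  have "\<exists>y. y \<in> S \<and> (\<forall>s\<in>S. (x - y) \<bullet> s = 0)" for x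
  proof -
    obtain y z where "y \<in> span S" "\<And>w. w \<in> span S \<Longrightarrow> orthogonal z w" "x = y + z"
      using orthogonal_subspace_decomp_exists[of S x] by metis
    moreover have "span S = S" using assms by (simp add: span_eq_iff)
    ultimately show ?thesis
      by (intro exI[of _ y]) (auto simp: orthogonal_def)
  qed
  then obtain f where f: "\<And>x. f x \<in> S" "\<And>x s. s \<in> S \<Longrightarrow> (x - f x) \<bullet> s = 0"
    by metis
  have lin: "linear f"
  proof (rule linearI)
    fix x y
    have "(x + y - (f x + f y)) \<bullet> s = 0" if "s \<in> S" for s
      using f(2)[OF that, of x] f(2)[OF that, of y] by (simp add: inner_diff_left inner_add_left)
    then show "f (x + y) = f x + f y"
      using f assms by (intro uniq[of _ _ "x + y"]) (auto simp: subspace_add)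
  next
    fix c x
    have "(c *\<^sub>R x - c *\<^sub>R f x) \<bullet> s = 0" if "s \<in> S" for s
      using f(2)[OF that, of x] by (simp add: inner_diff_left)
    then show "f (c *\<^sub>R x) = c *\<^sub>R f x"
      using f assms by (intro uniq[of _ _ "c *\<^sub>R x"]) (auto simp: subspace_scale)
  qed
  show ?thesis
  proof (rule ex1I[of _ "matrix f"])
    show "\<forall>x. matrix f *v x \<in> S \<and> (\<forall>s\<in>S. (x - matrix f *v x) \<bullet> s = 0)"
      using f lin by (simp add: matrix_works)
  next
    fix P assume P: "\<forall>x. P *v x \<in> S \<and> (\<forall>s\<in>S. (x - P *v x) \<bullet> s = 0)"
    have "P *v x = matrix f *v x" for x
      using P f lin by (intro uniq[of _ _ x]) (auto simp: matrix_works)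
    then show "P = matrix f" by (simp add: matrix_eq)
  qed
qed

definition H_mat :: "real^'p^'n \<Rightarrow> 'p set \<Rightarrow> real^'n^'n" where
  "H_mat X \<tau> = orth_proj_mat (span ((\<lambda>i. column i X) ` \<tau>))"

definition O_mat :: "real^'p^'n \<Rightarrow> 'p set \<Rightarrow> 'p set \<Rightarrow> real^'n^'n" where
  "O_mat X \<tau> \<Lambda> =
     orth_proj_mat (span ((\<lambda>i. (mat 1 - H_mat X (\<tau> - \<Lambda>)) *v column i X) ` (\<Lambda> \<inter> \<tau>)))"

definition T_stat :: "real^'p^'n \<Rightarrow> 'p set \<Rightarrow> real^'n \<Rightarrow> ('p \<Rightarrow> real) \<Rightarrow> 'p set \<Rightarrow> ereal" where
  "T_stat X \<Lambda> y \<beta> \<tau> =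
     (let r = y - model_mult X \<Lambda> \<beta> in
      if \<exists>i\<in>\<Lambda> - \<tau>. \<beta> i \<noteq> 0 then \<infinity>
      else if \<Lambda> \<inter> \<tau> = {} then 0
      else ereal ((r \<bullet> (O_mat X \<tau> \<Lambda> *v r) / real (card (\<Lambda> \<inter> \<tau>))) /
                  (r \<bullet> ((mat 1 - H_mat X \<tau>) *v r) / (real CARD('n) - real (card \<tau>)))))"

text \<open>There are no residual degrees of freedom when \<open>n \<le> card \<tau>\<close>. The convention for such a model
  (with \<open>\<Lambda> \<inter> \<tau> \<noteq> {}\<close>) is the empty acceptance region, so that it adds nothing to the
  confidence set.\<close>

definition B_set :: "nat \<Rightarrow> real \<Rightarrow> 'p set \<Rightarrow> 'p set \<Rightarrow> ereal set" where
  "B_set n \<alpha> \<Lambda> \<tau> =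
     (if \<Lambda> \<inter> \<tau> = {} then {0}
      else if n \<le> card \<tau> then {}
      else {0 .. ereal (F_quantile (card (\<Lambda> \<inter> \<tau>)) (n - card \<tau>) \<alpha>)})"

text \<open>Subvectors indexed by \<open>\<Lambda>\<close> are the extensional functions on \<open>\<Lambda>\<close>.\<close>

definition conf_set ::
    "real \<Rightarrow> 'p set \<Rightarrow> real^'p^'n \<Rightarrow> 'p set set \<Rightarrow> real^'n \<Rightarrow> ('p \<Rightarrow> real) set" where
  "conf_set \<alpha> \<Lambda> X S y =
     (\<Union>\<tau>\<in>S. {\<beta> \<in> \<Lambda> \<rightarrow>\<^sub>E UNIV. T_stat X \<Lambda> y \<beta> \<tau> \<in> B_set CARD('n) \<alpha> \<Lambda> \<tau>})"


section \<open>Probability\<close>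

definition coverage_event ::
    "'a measure \<Rightarrow> ('p set set \<Rightarrow> 'p set) \<Rightarrow> real^'p^'n \<Rightarrow> 'p set \<Rightarrow> ('p \<Rightarrow> real) \<Rightarrow> real \<Rightarrow>
     ('a \<Rightarrow> real^'n) \<Rightarrow> (nat \<Rightarrow> 'a \<Rightarrow> real^'n) \<Rightarrow> real \<Rightarrow> 'p set \<Rightarrow> real \<Rightarrow> nat \<Rightarrow> 'a set" where
  "coverage_event M tie X \<tau>\<^sub>0 \<beta>\<^sub>0 \<sigma>\<^sub>0 U Us \<alpha> \<Lambda> lam d =
     {\<omega> \<in> space M.
        let y = response X \<tau>\<^sub>0 \<beta>\<^sub>0 \<sigma>\<^sub>0 (U \<omega>) in
        restrict (full_coeff \<tau>\<^sub>0 \<beta>\<^sub>0) \<Lambda> \<in>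
          conf_set \<alpha> \<Lambda> X (cand_set tie X lam y (\<lambda>b. Us b \<omega>) d) y}"

text \<open>The \<open>\<sigma>\<close>-algebra generated by the first \<open>d\<close> repro samples.\<close>

definition sigma_U :: "'a measure \<Rightarrow> (nat \<Rightarrow> 'a \<Rightarrow> real^'n) \<Rightarrow> nat \<Rightarrow> 'a measure" where
  "sigma_U M Us d =
     vimage_algebra (space M) (\<lambda>\<omega>. \<lambda>b\<in>{..<d}. Us b \<omega>) (\<Pi>\<^sub>M b\<in>{..<d}. borel)"

text \<open>\<open>R d = o\<^sub>p(a d)\<close>, that is, \<open>R d / a d\<close> tends to 0 in probability.\<close>

definition small_op :: "'a measure \<Rightarrow> (nat \<Rightarrow> 'a \<Rightarrow> real) \<Rightarrow> (nat \<Rightarrow> real) \<Rightarrow> bool" where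
  "small_op M R a \<longleftrightarrow>
     (\<forall>\<epsilon>>0. (\<lambda>d. measure M {\<omega> \<in> space M. \<bar>R d \<omega> / a d\<bar> > \<epsilon>}) \<longlonglongrightarrow> 0)"

end

theory Submission
  imports Defs
begin

text \<open>Fix a realization \<open>u\<close> of the noise. If a repro sample \<open>v\<close> is close enough to \<open>u\<close>, then the loss of
  the true model is at most \<open>\<sigma>\<^sub>0\<^sup>2 |u - v|\<^sup>2 + lam |\<tau>\<^sub>0|\<close>, hence smaller than that of every larger model. A
  different model \<open>\<tau>\<close> that is not larger loses as soon as the squared distance from the mean to
  \<open>span (X\<^sub>\<tau>, u)\<close> exceeds \<open>lam |\<tau>\<^sub>0|\<close>. This distance is positive for almost every \<open>u\<close>, because by identifiability it
  vanishes only on a subspace of dimension at most \<open>|\<tau>\<^sub>0| + 1 < n\<close>. So there is \<open>\<kappa> > 0\<close>,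
  independent of \<open>lam\<close>, below all these distances with probability above \<open>1 - \<delta>\<close>, and \<open>\<gamma>\<close> is chosen so
  small that \<open>lam |\<tau>\<^sub>0| < \<kappa>\<close> on the whole interval.

  The pairs \<open>(u, v)\<close> for which \<open>\<tau>\<^sub>0\<close> is recovered contain an open neighbourhood of the diagonal over a
  compact set \<open>K\<close> of probability above \<open>1 - \<delta>\<close>. Cover \<open>K\<close> by finitely many open sets \<open>V\<close> with
  \<open>V \<times> V\<close> inside this neighbourhood: if the noise lies in \<open>K\<close> and every \<open>V\<close> is hit by one of the \<open>d\<close> repro samples,
  then \<open>\<tau>\<^sub>0\<close> is a candidate. The event that some \<open>V\<close> is missed depends only on the repro samples and its
  probability decays exponentially in \<open>d\<close>; it is independent of the noise, so its indicator serves as the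
  remainder also conditionally on the repro samples. Coverage at \<open>\<tau>\<^sub>0\<close> itself is the exact law
  of the \<open>F\<close> statistic.\<close>

section \<open>Standard normal vectors\<close>

definition std_normal_vec :: "(real^'n) measure" where
  "std_normal_vec = density lborel (\<lambda>u. ennreal (std_normal_vec_density u))"

text \<open>The coordinate densities multiply to a function of the norm alone. Positivity and
  rotation invariance are read off from this form.\<close>

lemma std_normal_vec_density_eq:
  "std_normal_vec_density (u::real^'n) = (1 / sqrt (2 * pi)) ^ CARD('n) * exp (- (norm u)\<^sup>2 / 2)"
proof -
  have "(norm u)\<^sup>2 = (\<Sum>i\<in>UNIV. (u $ i)\<^sup>2)"
    by (simp add: norm_vec_def L2_set_def sum_nonneg)
  then have "exp (- (norm u)\<^sup>2 / 2) = (\<Prod>i\<in>UNIV. exp (- (u $ i)\<^sup>2 / 2))"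
    by (simp add: exp_sum[symmetric] sum_negf sum_divide_distrib)
  then show ?thesis
    by (simp add: std_normal_vec_density_def std_normal_density_def prod_dividef power_one_over)
qed

lemma std_normal_vec_density_pos: "std_normal_vec_density (u::real^'n) > 0"
  by (simp add: std_normal_vec_density_eq)

lemma measurable_std_normal_vec_density [measurable]:
  "(std_normal_vec_density :: real^'n \<Rightarrow> real) \<in> borel_measurable borel"
  unfolding std_normal_vec_density_eq by measurable

lemma sets_std_normal_vec [measurable_cong, simp]: "sets std_normal_vec = sets borel"
  by (simp add: std_normal_vec_def)

lemma space_std_normal_vec [simp]: "space std_normal_vec = UNIV"
  by (simp add: std_normal_vec_def)

lemma Basis_vec_eq: "(Basis :: (real^'n) set) = range (\<lambda>i. axis i 1)"
  by (auto simp: Basis_vec_def)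

lemma inj_axis: "inj (\<lambda>i::'n::finite. axis i (1::real))"
  by (auto simp: inj_on_def axis_eq_axis)

text \<open>The density is a product over coordinates, so Tonelli splits the integral.
  \<open>nn_integral_lborel_prod\<close> multiplies over basis vectors; \<open>?inv\<close>
  translates \<open>axis i 1\<close> back to the index \<open>i\<close>.\<close>

lemma emeasure_std_normal_vec_PiE:
  fixes A :: "'n::finite \<Rightarrow> real set"
  assumes A: "\<And>i. A i \<in> sets borel"
  shows "emeasure std_normal_vec {u. \<forall>i. u $ i \<in> A i} = (\<Prod>i\<in>UNIV. emeasure std_normal_distribution (A i))"
proof -
  note A[measurable]
  let ?f = "\<lambda>i (x::real). ennreal (std_normal_density x) * indicator (A i) x"
  let ?inv = "the_inv (\<lambda>i::'n. axis i (1::real))"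
  have inv: "?inv (axis i 1) = i" for i by (rule the_inv_f_f[OF inj_axis])
  have m: "{u::real^'n. \<forall>i. u $ i \<in> A i} \<in> sets borel" by measurable
  have reindex: "(\<Prod>b\<in>Basis. g b) = (\<Prod>i\<in>UNIV. g (axis i (1::real)))" for g :: "real^'n \<Rightarrow> ennreal"
    unfolding Basis_vec_eq by (subst prod.reindex[OF inj_axis]) simp
  have "emeasure std_normal_vec {u. \<forall>i. u $ i \<in> A i}
      = (\<integral>\<^sup>+u. ennreal (std_normal_vec_density u) * indicator {u. \<forall>i. u $ i \<in> A i} u \<partial>lborel)"
    unfolding std_normal_vec_def using m by (subst emeasure_density) auto
  also have "\<dots> = (\<integral>\<^sup>+u. (\<Prod>b\<in>Basis. ?f (?inv b) (u \<bullet> b)) \<partial>(lborel :: (real^'n) measure))"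
  proof (rule nn_integral_cong)
    fix u :: "real^'n"
    have "(\<Prod>i\<in>UNIV. indicator (A i) (u $ i)) = (indicator {u. \<forall>i. u $ i \<in> A i} u :: ennreal)"
      by (auto simp: indicator_def intro!: prod_zero)
    then show "ennreal (std_normal_vec_density u) * indicator {u. \<forall>i. u $ i \<in> A i} u
        = (\<Prod>b\<in>Basis. ?f (?inv b) (u \<bullet> b))"
      by (simp add: reindex inv inner_axis prod.distrib std_normal_vec_density_def prod_ennreal)
  qed
  also have "\<dots> = (\<Prod>b\<in>Basis. \<integral>\<^sup>+x. ?f (?inv b) x \<partial>lborel)"
    by (rule nn_integral_lborel_prod) auto
  also have "\<dots> = (\<Prod>i\<in>UNIV. emeasure std_normal_distribution (A i))"
    by (simp add: reindex inv emeasure_density)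
  finally show ?thesis .
qed

lemma prob_space_std_normal_vec: "prob_space (std_normal_vec :: (real^'n) measure)"
proof
  interpret prob_space std_normal_distribution by (rule prob_space_normal_density) simp
  show "emeasure (std_normal_vec :: (real^'n) measure) (space std_normal_vec) = 1"
    using emeasure_std_normal_vec_PiE[of "\<lambda>_::'n. UNIV"] emeasure_space_1 by simp
qed

text \<open>Boxes determine a product measure, and \<open>emeasure_std_normal_vec_PiE\<close> gives
  their mass. This transports facts on independent normal coordinates to
  \<open>std_normal_vec\<close>.\<close>

lemma distr_std_normal_vec_coords:
  "distr (std_normal_vec :: (real^'n) measure) (\<Pi>\<^sub>M i\<in>UNIV. std_normal_distribution) (\<lambda>u i. u $ i)
    = (\<Pi>\<^sub>M i\<in>UNIV. std_normal_distribution)"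
proof -
  interpret prob_space std_normal_distribution by (rule prob_space_normal_density) simp
  interpret product_sigma_finite "\<lambda>_::'n. std_normal_distribution" ..
  have m: "(\<lambda>(u::real^'n) i. u $ i) \<in> measurable std_normal_vec (\<Pi>\<^sub>M i\<in>UNIV. std_normal_distribution)"
    by (rule measurable_PiM_single') auto
  show ?thesis
  proof (rule PiM_eqI)
    fix A :: "'n \<Rightarrow> real set" assume A: "\<And>i. i \<in> UNIV \<Longrightarrow> A i \<in> sets std_normal_distribution"
    have "(\<lambda>(u::real^'n) i. u $ i) -` Pi\<^sub>E UNIV A \<inter> space std_normal_vec = {u. \<forall>i. u $ i \<in> A i}"
      by (auto simp: PiE_iff)
    then show "emeasure (distr std_normal_vec (\<Pi>\<^sub>M i\<in>UNIV. std_normal_distribution) (\<lambda>u i. u $ i)) (Pi\<^sub>E UNIV A)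
        = (\<Prod>i\<in>UNIV. emeasure std_normal_distribution (A i))"
      using A m by (subst emeasure_distr) (auto intro!: sets_PiM_I_finite emeasure_std_normal_vec_PiE)
  qed auto
qed

section \<open>Rotation invariance of the standard normal law\<close>

lemma orthogonal_transformation_borel_measurable:
  fixes f :: "real^'n \<Rightarrow> real^'n"
  shows "orthogonal_transformation f \<Longrightarrow> f \<in> borel_measurable borel"
  by (intro borel_measurable_continuous_onI linear_continuous_on)
     (simp add: orthogonal_transformation_linear linear_conv_bounded_linear[symmetric])

text \<open>The linear change of variables in the library needs a well-ordered index type, so rotation
  invariance of \<open>lborel\<close> is transferred from a well-ordered copy of the index type.\<close>

typedef 'n wellordered = "UNIV :: 'n set"
  by simp

instance wellordered :: (finite) finite
  by standard (simp add: type_definition.univ[OF type_definition_wellordered])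

instantiation wellordered :: (finite) wellorder
begin

text \<open>Any well-order of the finite copy would do; this one is pulled back from an injective
  numbering by natural numbers.\<close>

definition less_eq_wellordered :: "'a wellordered \<Rightarrow> 'a wellordered \<Rightarrow> bool" where
  "less_eq_wellordered x y \<longleftrightarrow> to_nat_on UNIV x \<le> to_nat_on UNIV y"

definition less_wellordered :: "'a wellordered \<Rightarrow> 'a wellordered \<Rightarrow> bool" where
  "less_wellordered x y \<longleftrightarrow> to_nat_on UNIV x < to_nat_on UNIV y"

instance
proof
  fix x y :: "'a wellordered" assume "x \<le> y" "y \<le> x"
  then show "x = y"
    using inj_on_to_nat_on[of "UNIV :: 'a wellordered set"]
    by (auto simp: less_eq_wellordered_def inj_on_def)
next
  fix P :: "'a wellordered \<Rightarrow> bool" and a :: "'a wellordered" assume *: "\<And>x. (\<And>y. y < x \<Longrightarrow> P y) \<Longrightarrow> P x"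
  show "P a"
    by (induction a rule: measure_induct_rule[of "to_nat_on UNIV"])
      (use * in \<open>auto simp: less_wellordered_def\<close>)
qed (auto simp: less_eq_wellordered_def less_wellordered_def)

end

text \<open>Boxes determine \<open>lborel\<close>. The preimage of a box is its image under the
  inverse isometry, and isometries preserve Lebesgue measure.\<close>

lemma lborel_distr_orthogonal_wellorder:
  fixes f :: "real^'n::{finite,wellorder} \<Rightarrow> real^'n::_"
  assumes f: "orthogonal_transformation f"
  shows "distr lborel borel f = lborel"
proof (rule lborel_eqI[symmetric])
  fix l u :: "real^'n::_" assume lu: "\<And>b. b \<in> Basis \<Longrightarrow> l \<bullet> b \<le> u \<bullet> b"
  let ?g = "inv f"
  have g: "orthogonal_transformation ?g" by (rule orthogonal_transformation_inv[OF f])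
  have vim: "f -` box l u = ?g ` box l u"
    by (rule bij_vimage_eq_inv_image[OF orthogonal_transformation_bij[OF f]])
  have op: "open (f -` box l u)"
    using f by (intro open_vimage linear_continuous_on)
     (simp_all add: orthogonal_transformation_linear linear_conv_bounded_linear[symmetric] open_box)
  have "measure lborel (f -` box l u) = measure lebesgue (?g ` box l u)"
    using op by (simp add: vim[symmetric] measure_completion borel_open)
  also have "\<dots> = measure lebesgue (box l u)"
    by (rule measure_orthogonal_image[OF g]) simp
  also have "\<dots> = (\<Prod>b\<in>Basis. (u - l) \<bullet> b)"
    using lu by (simp add: measure_completion measure_lborel_box_eq)
  finally have 1: "measure lborel (f -` box l u) = (\<Prod>b\<in>Basis. (u - l) \<bullet> b)" .
  \<comment> \<open>\<open>measure\<close> sends infinite mass to 0, so finiteness is needed to lift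
    the real-valued equality to \<open>emeasure\<close>.\<close>
  have "bounded (?g ` box l u)"
    using g by (intro bounded_linear_image bounded_box)
      (simp add: orthogonal_transformation_linear linear_conv_bounded_linear[symmetric])
  then have "emeasure lborel (f -` box l u) < \<infinity>"
    unfolding vim by (rule emeasure_bounded_finite)
  then show "emeasure (distr lborel borel f) (box l u) = ennreal (\<Prod>b\<in>Basis. (u - l) \<bullet> b)"
    using 1 orthogonal_transformation_borel_measurable[OF f]
    by (subst emeasure_distr) (auto simp: emeasure_eq_ennreal_measure)
qed simp

text \<open>Reindexing only permutes the sides of a box, which leaves the product of their lengths
  unchanged.\<close>

lemma lborel_distr_reindex:
  fixes h :: "'m::finite \<Rightarrow> 'n::finite"
  assumes h: "bij h"
  shows "distr lborel borel (\<lambda>x :: real^'n. \<chi> i. x $ h i) = lborel"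
proof (rule lborel_eqI[symmetric])
  let ?f = "\<lambda>x :: real^'n. \<chi> i. x $ h i"
  fix l u :: "real^'m" assume lu: "\<And>b. b \<in> Basis \<Longrightarrow> l \<bullet> b \<le> u \<bullet> b"
  let ?g = "\<lambda>x :: real^'m. \<chi> j. x $ inv h j"
  have hi: "inv h (h i) = i" "h (inv h j) = j" for i j
    using h by (auto simp: bij_def surj_f_inv_f)
  have [measurable]: "?f \<in> borel_measurable borel"
    by (intro borel_measurable_continuous_onI continuous_intros)
  have vim: "?f -` box l u = box (?g l) (?g u)"
  proof -
    have "(\<forall>i. l $ i < x $ h i \<and> x $ h i < u $ i) \<longleftrightarrow> (\<forall>j. l $ inv h j < x $ j \<and> x $ j < u $ inv h j)" for x
      by (metis hi)
    then show ?thesis by (auto simp: mem_box_cart)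
  qed
  have le: "\<And>b. b \<in> Basis \<Longrightarrow> ?g l \<bullet> b \<le> ?g u \<bullet> b"
    using lu[of "axis i 1" for i] by (auto simp: Basis_vec_eq inner_axis)
  have "(\<Prod>b\<in>Basis. (?g u - ?g l) \<bullet> b) = (\<Prod>j\<in>UNIV. (u - l) $ inv h j)"
    unfolding Basis_vec_eq by (subst prod.reindex[OF inj_axis]) (simp add: inner_axis)
  also have "\<dots> = (\<Prod>i\<in>UNIV. (u - l) $ i)"
    using prod.reindex_bij_betw[OF bij_betw_inv_into[OF h]] by fastforce
  also have "\<dots> = (\<Prod>b\<in>Basis. (u - l) \<bullet> b)"
    unfolding Basis_vec_eq by (subst prod.reindex[OF inj_axis]) (simp add: inner_axis)
  finally show "emeasure (distr lborel borel ?f) (box l u) = ennreal (\<Prod>b\<in>Basis. (u - l) \<bullet> b)"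
    using le by (simp add: emeasure_distr vim emeasure_lborel_box_eq)
qed simp

text \<open>\<open>f\<close> is conjugated by the reindexing maps to an orthogonal map
  \<open>?g\<close> of the well-ordered copy, where invariance is known.\<close>

lemma lborel_distr_orthogonal_transformation:
  fixes f :: "real^'n \<Rightarrow> real^'n"
  assumes f: "orthogonal_transformation f"
  shows "distr lborel borel f = lborel"
proof -
  let ?\<phi> = "\<lambda>x :: real^'n wellordered. \<chi> i. x $ Abs_wellordered i"
  let ?\<psi> = "\<lambda>x :: real^'n. \<chi> i. x $ Rep_wellordered i"
  let ?g = "\<lambda>x. ?\<psi> (f (?\<phi> x))"
  have bij: "bij (Abs_wellordered :: 'n \<Rightarrow> _)" "bij (Rep_wellordered :: 'n wellordered \<Rightarrow> 'n)"
    by (auto intro!: o_bij[of Rep_wellordered] o_bij[of Abs_wellordered]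
        simp: fun_eq_iff Abs_wellordered_inverse Rep_wellordered_inverse)
  have inner: "?\<phi> x \<bullet> ?\<phi> y = x \<bullet> y" "?\<psi> v \<bullet> ?\<psi> w = v \<bullet> w" for x y v w
    using sum.reindex_bij_betw[OF bij(1), of "\<lambda>i. x $ i * y $ i"]
      sum.reindex_bij_betw[OF bij(2), of "\<lambda>i. v $ i * w $ i"]
    by (simp_all add: inner_vec_def)
  have [measurable]: "f \<in> borel_measurable borel"
    by (rule orthogonal_transformation_borel_measurable[OF f])
  have [measurable]: "?\<phi> \<in> borel_measurable borel" "?\<psi> \<in> borel_measurable borel"
    by (intro borel_measurable_continuous_onI continuous_intros)+
  have "linear ?\<phi>" "linear ?\<psi>" by (auto intro!: linearI simp: vec_eq_iff)
  then have "linear ?g"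
    using linear_compose[OF linear_compose[OF _ orthogonal_transformation_linear[OF f]], of ?\<phi> ?\<psi>]
    by (simp add: o_def)
  moreover have "?g x \<bullet> ?g y = x \<bullet> y" for x y
    using f by (simp add: inner orthogonal_transformation_def)
  ultimately have g: "orthogonal_transformation ?g"
    by (simp add: orthogonal_transformation_def)
  \<comment> \<open>\<open>?\<phi>\<close> intertwines \<open>?g\<close> and \<open>f\<close>;
    pushing \<open>lborel\<close> forward along both routes gives the invariance.\<close>
  have "f (?\<phi> x) = ?\<phi> (?g x)" for x
    by (simp add: vec_eq_iff Abs_wellordered_inverse)
  then have "distr (distr lborel borel ?\<phi>) borel f = distr (distr lborel borel ?g) borel ?\<phi>"
    by (simp add: distr_distr o_def)
  then show ?thesis
    by (simp add: lborel_distr_reindex[OF bij(1)] lborel_distr_orthogonal_wellorder[OF g])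
qed

lemma distr_std_normal_vec_orthogonal:
  fixes f :: "real^'n \<Rightarrow> real^'n"
  assumes f: "orthogonal_transformation f"
  shows "distr std_normal_vec borel f = std_normal_vec"
proof -
  have [measurable]: "f \<in> borel_measurable borel"
    by (rule orthogonal_transformation_borel_measurable[OF f])
  have "density lborel (\<lambda>u. ennreal (std_normal_vec_density (f u))) = (std_normal_vec :: (real^'n) measure)"
    unfolding std_normal_vec_def
    using orthogonal_transformation_norm[OF f] by (simp add: std_normal_vec_density_eq)
  then have "distr std_normal_vec borel f
      = distr (density lborel (\<lambda>u. ennreal (std_normal_vec_density (f u)))) borel f" by simp
  also have "\<dots> = density (distr lborel borel f) (\<lambda>u. ennreal (std_normal_vec_density u))"
    by (subst density_distr) auto
  also have "\<dots> = std_normal_vec"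
    by (simp add: lborel_distr_orthogonal_transformation[OF f] std_normal_vec_def)
  finally show ?thesis .
qed

section \<open>Open sets and null sets under the normal law\<close>

text \<open>The density vanishes nowhere, so a null set is Lebesgue null, which a nonempty open set
  is not. Hence a repro sample hits each set of the later finite cover with positive
  probability.\<close>

lemma std_normal_vec_open_pos:
  fixes V :: "(real^'n) set"
  assumes "open V" "V \<noteq> {}"
  shows "measure std_normal_vec V > 0"
proof -
  interpret prob_space "std_normal_vec :: (real^'n) measure" by (rule prob_space_std_normal_vec)
  have "emeasure std_normal_vec V \<noteq> 0"
  proof
    assume "emeasure std_normal_vec V = 0"
    then have "V \<in> null_sets (density lborel (\<lambda>u. ennreal (std_normal_vec_density u)))"
      using assms by (intro null_setsI) (auto simp: std_normal_vec_def)
    then have "AE x in lborel. x \<in> V \<longrightarrow> ennreal (std_normal_vec_density x) = 0"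
      by (subst (asm) null_sets_density_iff) auto
    then have "AE x in lborel. x \<notin> V"
      by (rule eventually_mono) (use std_normal_vec_density_pos in \<open>auto simp: ennreal_eq_0_iff simp flip: not_less\<close>)
    then have "V \<in> null_sets lborel" using assms AE_iff_null_sets[of V lborel] by simp
    then have "negligible V"
      using null_sets_completionI negligible_iff_null_sets by blast
    with open_not_negligible assms show False by blast
  qed
  then show ?thesis by (simp add: emeasure_eq_measure measure_nonneg order_less_le)
qed

lemma std_normal_vec_negligible:
  fixes S :: "(real^'n) set"
  assumes "negligible S" "S \<in> sets borel"
  shows "emeasure std_normal_vec S = 0"
proof -
  have "S \<in> null_sets lborel"
    using assms by (auto simp: null_sets_def negligible_iff_null_sets)
  then have "S \<in> null_sets std_normal_vec"
    unfolding std_normal_vec_def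
    by (subst null_sets_density_iff) (auto intro: AE_I' )
  then show ?thesis by auto
qed

section \<open>The \<open>F\<close> statistic of the true model\<close>

text \<open>The limits of the distribution function make the set nonempty and bounded below; right
  continuity then puts its infimum into the set, even if the distribution function jumps
  there.\<close>

lemma (in real_distribution) cdf_Inf_quantile:
  assumes "0 < \<alpha>" "\<alpha> < 1"
  shows "\<alpha> \<le> cdf M (Inf {x. \<alpha> \<le> cdf M x})"
proof (rule ccontr)
  let ?A = "{x. \<alpha> \<le> cdf M x}" and ?q = "Inf {x. \<alpha> \<le> cdf M x}"
  assume "\<not> \<alpha> \<le> cdf M ?q"
  then have lt: "cdf M ?q < \<alpha>" by simp
  have "eventually (\<lambda>x. \<alpha> < cdf M x) at_top"
    using order_tendstoD(1)[OF cdf_lim_at_top_prob assms(2)] .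
  then obtain x1 where "\<alpha> < cdf M x1"
    by (auto simp: eventually_at_top_linorder)
  then have ne: "?A \<noteq> {}" by (auto intro: less_imp_le)
  have "eventually (\<lambda>x. cdf M x < \<alpha>) at_bot"
    using cdf_lim_at_bot assms by (intro order_tendstoD)
  then obtain x0 where x0: "\<And>x. x \<le> x0 \<Longrightarrow> cdf M x < \<alpha>"
    by (auto simp: eventually_at_bot_linorder)
  have bdd: "bdd_below ?A"
    by (rule bdd_belowI[of _ x0]) (use x0 in \<open>auto simp: not_le[symmetric] intro!: less_imp_le\<close>)
  have "(cdf M \<longlongrightarrow> cdf M ?q) (at_right ?q)"
    using cdf_is_right_cont[of ?q] by (simp add: continuous_within)
  then have "eventually (\<lambda>x. cdf M x < \<alpha>) (at_right ?q)"
    using lt by (rule order_tendstoD)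
  then obtain y where y: "y > ?q" "\<And>x. ?q < x \<Longrightarrow> x < y \<Longrightarrow> cdf M x < \<alpha>"
    by (auto simp: eventually_at_right_field)
  obtain a where a: "a \<in> ?A" "a < y"
    using y(1) ne bdd by (meson cInf_lessD)
  have "?q \<le> a" using a bdd by (intro cInf_lower)
  then show False using a y(2)[of a] lt by (cases "a = ?q") auto
qed

lemma sets_chi_square_dist [measurable_cong, simp]: "sets (chi_square_dist k) = sets borel"
  by (simp add: chi_square_dist_def)

lemma prob_space_chi_square_dist: "prob_space (chi_square_dist k)"
proof -
  interpret S: prob_space std_normal_distribution by (rule prob_space_normal_density) simp
  interpret prob_space "\<Pi>\<^sub>M i\<in>{..<k}. std_normal_distribution" by (rule prob_space_PiM) unfold_locales
  show ?thesis unfolding chi_square_dist_def by (rule prob_space_distr) measurable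
qed

lemma real_distribution_F_dist: "real_distribution (F_dist k m)"
proof -
  interpret A: prob_space "chi_square_dist k" by (rule prob_space_chi_square_dist)
  interpret B: prob_space "chi_square_dist m" by (rule prob_space_chi_square_dist)
  interpret pair_prob_space "chi_square_dist k" "chi_square_dist m" ..
  have "prob_space (F_dist k m)"
    unfolding F_dist_def by (rule prob_space_distr) measurable
  then show ?thesis
    by (simp add: real_distribution_def real_distribution_axioms_def F_dist_def)
qed

section \<open>Chi-square laws of sums of squared coordinates\<close>

lemma distr_std_normal_vec_component:
  "distr (std_normal_vec :: (real^'n) measure) borel (\<lambda>u. u $ i) = std_normal_distribution"
proof -
  interpret S: prob_space std_normal_distribution by (rule prob_space_normal_density) simp
  have m: "(\<lambda>(u::real^'n) i. u $ i) \<in> measurable std_normal_vec (\<Pi>\<^sub>M i\<in>UNIV. std_normal_distribution)"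
    by (rule measurable_PiM_single') auto
  have "std_normal_distribution = distr (\<Pi>\<^sub>M i\<in>(UNIV :: 'n set). std_normal_distribution) std_normal_distribution (\<lambda>\<omega>. \<omega> i)"
    by (rule distr_PiM_component[symmetric]) (auto intro: S.prob_space_axioms)
  also have "\<dots> = distr (std_normal_vec :: (real^'n) measure) std_normal_distribution (\<lambda>u. u $ i)"
    by (subst distr_std_normal_vec_coords[symmetric], subst distr_distr[OF _ m]) (auto simp: o_def)
  also have "\<dots> = distr std_normal_vec borel (\<lambda>u. u $ i)"
    by (rule distr_cong) auto
  finally show ?thesis by simp
qed

lemma indep_vars_std_normal_vec:
  "prob_space.indep_vars (std_normal_vec :: (real^'n) measure) (\<lambda>_. borel) (\<lambda>i u. u $ i) UNIV"
proof -
  interpret prob_space "std_normal_vec :: (real^'n) measure" by (rule prob_space_std_normal_vec)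
  have "distr (std_normal_vec :: (real^'n) measure) (\<Pi>\<^sub>M i\<in>UNIV. borel) (\<lambda>u i. u $ i)
      = (\<Pi>\<^sub>M i\<in>UNIV. std_normal_distribution)"
    by (subst distr_std_normal_vec_coords[symmetric], rule distr_cong) (simp_all cong: sets_PiM_cong)
  then show ?thesis
    by (subst indep_vars_iff_distr_eq_PiM') (auto simp: distr_std_normal_vec_component restrict_def)
qed

text \<open>Selecting \<open>k\<close> distinct coordinates along the injection \<open>f\<close>
  turns the full product measure into the one that defines \<open>chi_square_dist k\<close>.\<close>

lemma distr_std_normal_vec_sum_squares:
  fixes f :: "nat \<Rightarrow> 'n::finite"
  assumes f: "inj_on f {..<k}"
  shows "distr std_normal_vec borel (\<lambda>z. \<Sum>i<k. (z $ f i)\<^sup>2) = chi_square_dist k"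
proof -
  interpret S: prob_space std_normal_distribution by (rule prob_space_normal_density) simp
  have m: "(\<lambda>(u::real^'n) i. u $ i) \<in> measurable std_normal_vec (\<Pi>\<^sub>M i\<in>UNIV. std_normal_distribution)"
    by (rule measurable_PiM_single') auto
  let ?Q = "\<Pi>\<^sub>M i\<in>(UNIV :: 'n set). std_normal_distribution"
  let ?K = "\<Pi>\<^sub>M i\<in>{..<k}. std_normal_distribution"
  have "chi_square_dist k = distr (distr ?Q ?K (\<lambda>\<omega>. \<lambda>n\<in>{..<k}. \<omega> (f n))) borel (\<lambda>z. \<Sum>i<k. (z i)\<^sup>2)"
    unfolding chi_square_dist_def
    using f S.prob_space_axioms by (subst distr_PiM_reindex) auto
  also have "\<dots> = distr ?Q borel (\<lambda>\<omega>. \<Sum>i<k. (\<omega> (f i))\<^sup>2)"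
    by (subst distr_distr) (auto simp: o_def intro!: measurable_restrict)
  also have "\<dots> = distr std_normal_vec borel (\<lambda>z. \<Sum>i<k. (z $ f i)\<^sup>2)"
    by (subst distr_std_normal_vec_coords[symmetric], subst distr_distr[OF _ m]) (auto simp: o_def)
  finally show ?thesis by simp
qed

text \<open>The two sums use disjoint sets of coordinates, hence are independent, and their joint
  law is the product of the marginals.\<close>

lemma distr_std_normal_vec_sum_squares_pair:
  fixes f g :: "nat \<Rightarrow> 'n::finite"
  assumes f: "inj_on f {..<k}" and g: "inj_on g {..<m}" and fg: "f ` {..<k} \<inter> g ` {..<m} = {}"
  shows "distr std_normal_vec (borel \<Otimes>\<^sub>M borel) (\<lambda>z. (\<Sum>i<k. (z $ f i)\<^sup>2, \<Sum>j<m. (z $ g j)\<^sup>2))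
    = chi_square_dist k \<Otimes>\<^sub>M chi_square_dist m"
proof -
  interpret prob_space "std_normal_vec :: (real^'n) measure" by (rule prob_space_std_normal_vec)
  let ?A = "f ` {..<k}" and ?B = "g ` {..<m}"
  have "indep_var borel ((\<lambda>\<omega>. \<Sum>i<k. (\<omega> (f i))\<^sup>2) \<circ> (\<lambda>u::real^'n. restrict (\<lambda>i. u $ i) ?A))
      borel ((\<lambda>\<omega>. \<Sum>j<m. (\<omega> (g j))\<^sup>2) \<circ> (\<lambda>u. restrict (\<lambda>i. u $ i) ?B))"
    by (rule indep_var_compose[OF indep_var_restrict[OF indep_vars_std_normal_vec fg]])
      (auto intro!: borel_measurable_sum borel_measurable_power measurable_component_singleton)
  then have "indep_var borel (\<lambda>u::real^'n. \<Sum>i<k. (u $ f i)\<^sup>2) borel (\<lambda>u. \<Sum>j<m. (u $ g j)\<^sup>2)"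
    by (simp add: o_def)
  then show ?thesis
    unfolding indep_var_distribution_eq
    by (simp add: distr_std_normal_vec_sum_squares[OF f] distr_std_normal_vec_sum_squares[OF g])
qed

section \<open>Orthogonal projections and their joint law\<close>

lemma orth_proj_mat_props:
  fixes S :: "(real^'n) set"
  assumes "subspace S"
  shows "orth_proj_mat S *v x \<in> S" "s \<in> S \<Longrightarrow> (x - orth_proj_mat S *v x) \<bullet> s = 0"
  using theI'[OF orth_proj_mat_unique[OF assms]] unfolding orth_proj_mat_def by auto

text \<open>The difference of the two candidates lies in \<open>S\<close> and is orthogonal to
  itself. Explicit projections below are computed from this characterization.\<close>

lemma orth_proj_mat_eqI:
  fixes S :: "(real^'n) set"
  assumes S: "subspace S" and a: "a \<in> S" "\<And>s. s \<in> S \<Longrightarrow> (x - a) \<bullet> s = 0"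
  shows "orth_proj_mat S *v x = a"
proof -
  let ?d = "orth_proj_mat S *v x - a"
  have d: "?d \<in> S" using orth_proj_mat_props(1)[OF S] a S by (simp add: subspace_diff)
  have "?d \<bullet> ?d = (x - a) \<bullet> ?d - (x - orth_proj_mat S *v x) \<bullet> ?d"
    by (simp add: inner_diff_left)
  then have "?d \<bullet> ?d = 0" using a(2)[OF d] orth_proj_mat_props(2)[OF S d] by simp
  then show ?thesis by simp
qed

lemma inner_orth_proj_mat:
  fixes S :: "(real^'n) set"
  assumes S: "subspace S"
  shows "x \<bullet> (orth_proj_mat S *v x) = (norm (orth_proj_mat S *v x))\<^sup>2"
  using orth_proj_mat_props(2)[OF S orth_proj_mat_props(1)[OF S, of x], of x]
  by (simp add: inner_diff_left power2_norm_eq_inner)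

text \<open>Makes the residual quadratic form of the statistic the squared norm of a projection too,
  so that numerator and denominator can be treated alike.\<close>

lemma orth_proj_mat_orthogonal_complement:
  fixes S :: "(real^'n) set"
  assumes S: "subspace S"
  shows "(mat 1 - orth_proj_mat S) *v x = orth_proj_mat {y. \<forall>s\<in>S. orthogonal s y} *v x"
proof (rule orth_proj_mat_eqI[symmetric])
  show "subspace {y. \<forall>s\<in>S. orthogonal s y}" 
    by (auto simp: subspace_def orthogonal_def inner_simps)
  show "(mat 1 - orth_proj_mat S) *v x \<in> {y. \<forall>s\<in>S. orthogonal s y}"
    using orth_proj_mat_props(2)[OF S]
    by (simp add: matrix_vector_mult_diff_rdistrib orthogonal_def inner_commute)
  show "(x - (mat 1 - orth_proj_mat S) *v x) \<bullet> s = 0" if "s \<in> {y. \<forall>s\<in>S. orthogonal s y}" for s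
    using that orth_proj_mat_props(1)[OF S] 
    by (simp add: matrix_vector_mult_diff_rdistrib orthogonal_def)
qed

lemma norm_orth_proj_mat_basis:
  fixes B :: "(real^'n) set"
  assumes B: "pairwise orthogonal B" "\<And>b. b \<in> B \<Longrightarrow> norm b = 1" "finite B"
  shows "(norm (orth_proj_mat (span B) *v x))\<^sup>2 = (\<Sum>b\<in>B. (x \<bullet> b)\<^sup>2)"
proof -
  let ?a = "\<Sum>b\<in>B. (x \<bullet> b) *\<^sub>R b"
  have ab: "?a \<bullet> b = x \<bullet> b" if b: "b \<in> B" for b
  proof -
    have "?a \<bullet> b = (\<Sum>c\<in>B. (x \<bullet> c) * (c \<bullet> b))" by (simp add: inner_sum_left)
    also have "\<dots> = (\<Sum>c\<in>B. if c = b then x \<bullet> b else 0)"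
      using B b by (intro sum.cong) (auto simp: pairwise_def orthogonal_def norm_eq_1)
    finally show ?thesis using B b by simp
  qed
  have "orth_proj_mat (span B) *v x = ?a"
  proof (rule orth_proj_mat_eqI)
    show "?a \<in> span B" by (intro span_sum span_scale span_base)
    fix s assume "s \<in> span B"
    moreover have "\<And>b. b \<in> B \<Longrightarrow> orthogonal (x - ?a) b"
      using ab by (simp add: orthogonal_def inner_diff_left)
    ultimately show "(x - ?a) \<bullet> s = 0"
      using orthogonal_to_span unfolding orthogonal_def by blast
  qed simp
  moreover have "(norm ?a)\<^sup>2 = ?a \<bullet> ?a" by (simp add: power2_norm_eq_inner)
  moreover have "?a \<bullet> ?a = (\<Sum>b\<in>B. (x \<bullet> b) * (?a \<bullet> b))" by (simp only: inner_sum_right inner_scaleR_right)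
  ultimately show ?thesis using ab by (simp add: power2_eq_square)
qed

text \<open>Expansion in an orthonormal basis preserves inner products; the normal law may therefore
  be studied in coordinates adapted to given subspaces.\<close>

lemma orthonormal_coordinates:
  fixes h :: "'n::finite \<Rightarrow> real^'n"
  assumes h: "inj h" "pairwise orthogonal (range h)" "\<And>i. norm (h i) = 1"
  shows "orthogonal_transformation (\<lambda>z::real^'n. \<Sum>i\<in>UNIV. z $ i *\<^sub>R h i)"
    and "(\<Sum>i\<in>UNIV. z $ i *\<^sub>R h i) \<bullet> h j = (z::real^'n) $ j"
proof -
  let ?W = "\<lambda>z::real^'n. \<Sum>i\<in>UNIV. z $ i *\<^sub>R h i"
  have hh: "h i \<bullet> h j = (if i = j then 1 else 0)" for i j
    using h by (auto simp: pairwise_def orthogonal_def norm_eq_1 inj_def)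
  show W: "?W z \<bullet> h j = z $ j" for z j
    by (simp add: inner_sum_left hh if_distrib[of "\<lambda>c. _ * c"] cong: if_cong)
  have "?W z \<bullet> ?W w = z \<bullet> w" for z w
  proof -
    have "?W z \<bullet> ?W w = (\<Sum>i\<in>UNIV. w $ i * (?W z \<bullet> h i))"
      by (simp only: inner_sum_right inner_scaleR_right)
    then show ?thesis unfolding W by (simp add: inner_vec_def mult.commute)
  qed
  moreover have "linear ?W"
    by (rule linearI) (simp_all add: scaleR_left_distrib sum.distrib scaleR_sum_right)
  ultimately show "orthogonal_transformation ?W" by (simp add: orthogonal_transformation_def)
qed

text \<open>Orthonormal bases of \<open>A\<close> and \<open>C\<close> are completed to one of the
  whole space. In these coordinates, standard normal by rotation invariance, the squared projections
  are sums of squares over disjoint index sets.\<close>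

lemma distr_std_normal_vec_projections:
  fixes A C :: "(real^'n) set"
  assumes A: "subspace A" and C: "subspace C" and AC: "\<And>a c. a \<in> A \<Longrightarrow> c \<in> C \<Longrightarrow> orthogonal a c"
  shows "distr std_normal_vec (borel \<Otimes>\<^sub>M borel)
      (\<lambda>u. ((norm (orth_proj_mat A *v u))\<^sup>2, (norm (orth_proj_mat C *v u))\<^sup>2))
    = chi_square_dist (dim A) \<Otimes>\<^sub>M chi_square_dist (dim C)"
proof -
  obtain BA where BA: "BA \<subseteq> A" "pairwise orthogonal BA" "\<And>x. x \<in> BA \<Longrightarrow> norm x = 1"
      "independent BA" "card BA = dim A" "span BA = A"
    using orthonormal_basis_subspace[OF A] by metis
  obtain BC where BC: "BC \<subseteq> C" "pairwise orthogonal BC" "\<And>x. x \<in> BC \<Longrightarrow> norm x = 1"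
      "independent BC" "card BC = dim C" "span BC = C"
    using orthonormal_basis_subspace[OF C] by metis
  define D where "D = {y. \<forall>x\<in>span (BA \<union> BC). orthogonal x y}"
  have D: "subspace D" by (auto simp: D_def subspace_def orthogonal_def inner_simps)
  obtain BD where BD: "BD \<subseteq> D" "pairwise orthogonal BD" "\<And>x. x \<in> BD \<Longrightarrow> norm x = 1"
      "independent BD" "card BD = dim D" "span BD = D"
    using orthonormal_basis_subspace[OF D] by metis
  have fin: "finite BA" "finite BC" "finite BD"
    using BA(4) BC(4) BD(4) by (auto intro: independent_imp_finite)
  have oAC: "orthogonal x y \<and> orthogonal y x" if "x \<in> BA" "y \<in> BC" for x y
    using that AC BA(1) BC(1) by (auto simp: orthogonal_commute)
  have pAC: "pairwise orthogonal (BA \<union> BC)"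
    using BA(2) BC(2) oAC by (auto simp: pairwise_def)
  have disjAC: "BA \<inter> BC = {}"
    using oAC BA(3) by (fastforce simp: orthogonal_def norm_eq_1)
  have oD: "orthogonal x y \<and> orthogonal y x" if "x \<in> BA \<union> BC" "y \<in> BD" for x y
    using that BD(1) span_base[of x "BA \<union> BC"] unfolding D_def by (auto simp: orthogonal_commute)
  have disjD: "(BA \<union> BC) \<inter> BD = {}"
    using oD BD(3) by (fastforce simp: orthogonal_def norm_eq_1)
  let ?B = "BA \<union> BC \<union> BD"
  have pB: "pairwise orthogonal ?B"
    using pAC BD(2) oD unfolding pairwise_def by blast
  have nB: "\<And>b. b \<in> ?B \<Longrightarrow> norm b = 1" using BA BC BD by auto
  have "independent (BA \<union> BC)"
    using pAC nB by (intro pairwise_orthogonal_independent) force+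
  then have dAC: "dim (span (BA \<union> BC)) = card (BA \<union> BC)" by (rule dim_span_eq_card_independent)
  \<comment> \<open>The dimension formula makes the completed basis as large as the index type, so
    that \<open>'n\<close> can enumerate it.\<close>
  have "dim {y \<in> UNIV. \<forall>x\<in>span (BA \<union> BC). orthogonal x y} + dim (span (BA \<union> BC)) = dim (UNIV :: (real^'n) set)"
    by (rule dim_subspace_orthogonal_to_vectors) auto
  then have "card BD + card (BA \<union> BC) = CARD('n)"
    using BD(5) dAC by (simp add: D_def)
  then have "card ?B = card (UNIV :: 'n set)"
    using fin disjD by (simp add: card_Un_disjoint)
  then obtain h where h: "bij_betw h (UNIV :: 'n set) ?B"
    using fin finite_same_card_bij[of "UNIV :: 'n set" ?B] by auto
  then have hi: "inj h" "range h = ?B" by (auto simp: bij_betw_def)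
  have hp: "pairwise orthogonal (range h)" "norm (h i) = 1" for i
    using pB nB hi(2) by (auto simp del: Un_iff)
  let ?W = "\<lambda>z::real^'n. \<Sum>i\<in>UNIV. z $ i *\<^sub>R h i"
  note W = orthonormal_coordinates[OF hi(1) hp]
  \<comment> \<open>For any part \<open>B\<close> of the basis, the indices of its members pick out
    the coordinates whose squares add up to the squared projection.\<close>
  have coords: "\<exists>f :: nat \<Rightarrow> 'n. inj_on f {..<card B} \<and> (\<forall>i<card B. h (f i) \<in> B) \<and>
      (\<forall>z. (norm (orth_proj_mat (span B) *v ?W z))\<^sup>2 = (\<Sum>i<card B. (z $ f i)\<^sup>2))"
    if B: "B \<subseteq> ?B" for B
  proof -
    have fB: "finite B" using B fin by (meson finite_Un finite_subset)
    obtain e where e: "bij_betw e {..<card B} B"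
      using ex_bij_betw_nat_finite[OF fB] by (auto simp: atLeast0LessThan)
    have hinv: "h (inv h b) = b" if "b \<in> B" for b
      using that B hi(2) by (metis f_inv_into_f subsetD)
    let ?f = "\<lambda>i. inv h (e i)"
    have eB: "e i \<in> B" if "i < card B" for i using e that by (auto simp: bij_betw_def)
    have "inj_on ?f {..<card B}"
      using e eB hinv unfolding bij_betw_def inj_on_def by (metis lessThan_iff)
    moreover have "(norm (orth_proj_mat (span B) *v ?W z))\<^sup>2 = (\<Sum>i<card B. (z $ ?f i)\<^sup>2)" for z
    proof -
      have "(norm (orth_proj_mat (span B) *v ?W z))\<^sup>2 = (\<Sum>b\<in>B. (?W z \<bullet> b)\<^sup>2)"
        using B pB nB fB by (intro norm_orth_proj_mat_basis) (auto intro: pairwise_subset)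
      also have "\<dots> = (\<Sum>i<card B. (?W z \<bullet> e i)\<^sup>2)"
        by (rule sum.reindex_bij_betw[OF e, symmetric])
      also have "\<dots> = (\<Sum>i<card B. (z $ ?f i)\<^sup>2)"
      proof (intro sum.cong refl)
        fix i assume "i \<in> {..<card B}"
        then show "(?W z \<bullet> e i)\<^sup>2 = (z $ ?f i)\<^sup>2"
          using W(2)[of z "?f i"] hinv[OF eB[of i]] by simp
      qed
      finally show ?thesis .
    qed
    ultimately show ?thesis using hinv eB by (intro exI[of _ ?f]) auto
  qed
  obtain f where f: "inj_on f {..<card BA}" "\<forall>i<card BA. h (f i) \<in> BA"
      "\<forall>z. (norm (orth_proj_mat (span BA) *v ?W z))\<^sup>2 = (\<Sum>i<card BA. (z $ f i)\<^sup>2)"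
    using coords[of BA] by blast
  obtain g where g: "inj_on g {..<card BC}" "\<forall>i<card BC. h (g i) \<in> BC"
      "\<forall>z. (norm (orth_proj_mat (span BC) *v ?W z))\<^sup>2 = (\<Sum>i<card BC. (z $ g i)\<^sup>2)"
    using coords[of BC] by blast
  have fg: "f ` {..<card BA} \<inter> g ` {..<card BC} = {}"
    using f(2) g(2) disjAC by fastforce
  have [measurable]: "(\<lambda>u. norm (orth_proj_mat S *v (u::real^'n))) \<in> borel_measurable borel" for S
    by (intro borel_measurable_continuous_onI continuous_intros)
  have [measurable]: "?W \<in> borel_measurable borel"
    by (rule orthogonal_transformation_borel_measurable[OF W(1)])
  \<comment> \<open>The law is replaced by its image under the orthogonal map \<open>?W\<close>,
    which turns both projections into coordinate sums.\<close>
  have "distr std_normal_vec (borel \<Otimes>\<^sub>M borel)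
      (\<lambda>u. ((norm (orth_proj_mat A *v u))\<^sup>2, (norm (orth_proj_mat C *v u))\<^sup>2))
    = distr (distr std_normal_vec borel ?W) (borel \<Otimes>\<^sub>M borel)
      (\<lambda>u. ((norm (orth_proj_mat A *v u))\<^sup>2, (norm (orth_proj_mat C *v u))\<^sup>2))"
    by (simp only: distr_std_normal_vec_orthogonal[OF W(1)])
  also have "\<dots> = distr std_normal_vec (borel \<Otimes>\<^sub>M borel)
      (\<lambda>z. (\<Sum>i<card BA. (z $ f i)\<^sup>2, \<Sum>j<card BC. (z $ g j)\<^sup>2))"
    using f(3) g(3) BA(6) BC(6) by (subst distr_distr) (auto simp: o_def)
  also have "\<dots> = chi_square_dist (dim A) \<Otimes>\<^sub>M chi_square_dist (dim C)"
    unfolding BA(5)[symmetric] BC(5)[symmetric]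
    by (rule distr_std_normal_vec_sum_squares_pair[OF f(1) g(1) fg])
  finally show ?thesis .
qed

text \<open>By the joint law of the two projections the ratio has the law \<open>F_dist\<close>,
  whose quantile has distribution function at least \<alpha>.\<close>

lemma std_normal_vec_F_quantile:
  fixes A C :: "(real^'n) set"
  assumes A: "subspace A" and C: "subspace C" and AC: "\<And>a c. a \<in> A \<Longrightarrow> c \<in> C \<Longrightarrow> orthogonal a c"
    and \<alpha>: "0 < \<alpha>" "\<alpha> < 1"
  shows "\<alpha> \<le> measure std_normal_vec
    {u. ((norm (orth_proj_mat A *v u))\<^sup>2 / real (dim A)) / ((norm (orth_proj_mat C *v u))\<^sup>2 / real (dim C))
        \<le> F_quantile (dim A) (dim C) \<alpha>}"
proof -
  let ?q = "F_quantile (dim A) (dim C) \<alpha>"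
  let ?P = "\<lambda>u. ((norm (orth_proj_mat A *v u))\<^sup>2, (norm (orth_proj_mat C *v u))\<^sup>2)"
  have [measurable]: "(\<lambda>u. norm (orth_proj_mat S *v (u::real^'n))) \<in> borel_measurable borel" for S
    by (intro borel_measurable_continuous_onI continuous_intros)
  have "\<alpha> \<le> measure (F_dist (dim A) (dim C)) {..?q}"
    using real_distribution.cdf_Inf_quantile[OF real_distribution_F_dist \<alpha>]
    unfolding F_quantile_def cdf_def .
  also have "F_dist (dim A) (dim C) = distr std_normal_vec borel
      ((\<lambda>(v, w). (v / real (dim A)) / (w / real (dim C))) \<circ> ?P)"
  proof -
    have "F_dist (dim A) (dim C) = distr (distr std_normal_vec (borel \<Otimes>\<^sub>M borel) ?P) borel
        (\<lambda>(v, w). (v / real (dim A)) / (w / real (dim C)))"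
      unfolding F_dist_def by (simp only: distr_std_normal_vec_projections[OF A C AC])
    then show ?thesis by (subst (asm) distr_distr) auto
  qed
  finally show ?thesis
    by (subst (asm) measure_distr) (auto simp: vimage_def)
qed

section \<open>Column spans and degrees of freedom under identifiability\<close>

lemma span_columns_eq_model_mult:
  "v \<in> span ((\<lambda>i. column i X) ` \<tau>) \<longleftrightarrow> (\<exists>\<beta>. v = model_mult X \<tau> \<beta>)"
proof
  assume "v \<in> span ((\<lambda>i. column i X) ` \<tau>)"
  then show "\<exists>\<beta>. v = model_mult X \<tau> \<beta>"
  proof (induction rule: span_induct_alt)
    case base
    show ?case by (rule exI[of _ "\<lambda>_. 0"]) (simp add: model_mult_def)
  next
    case (step c x y)
    then obtain i \<beta> where i: "i \<in> \<tau>" "x = column i X" "y = model_mult X \<tau> \<beta>" by auto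
    have "c *\<^sub>R x + y = model_mult X \<tau> (\<lambda>j. (if j = i then c else 0) + \<beta> j)"
      using i by (simp add: model_mult_def scaleR_left_distrib sum.distrib if_distrib
          [where f = "\<lambda>c. c *\<^sub>R _"] cong: if_cong)
    then show ?case by blast
  qed
qed (auto simp: model_mult_def intro!: span_sum span_scale intro: span_base)

lemma model_mult_in_span: "model_mult X \<tau> \<beta> \<in> span ((\<lambda>i. column i X) ` \<tau>)"
  using span_columns_eq_model_mult by blast

text \<open>A model no larger than \<open>\<tau>\<^sub>0\<close> that reproduces the mean would be a
  second minimizer.\<close>

lemma identifiable_not_in_span:
  assumes "identifiable X \<tau>\<^sub>0 \<beta>\<^sub>0" "\<tau> \<noteq> \<tau>\<^sub>0" "card \<tau> \<le> card \<tau>\<^sub>0"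
  shows "model_mult X \<tau>\<^sub>0 \<beta>\<^sub>0 \<notin> span ((\<lambda>i. column i X) ` \<tau>)"
proof
  assume "model_mult X \<tau>\<^sub>0 \<beta>\<^sub>0 \<in> span ((\<lambda>i. column i X) ` \<tau>)"
  then have ex: "\<exists>\<beta>. model_mult X \<tau> \<beta> = model_mult X \<tau>\<^sub>0 \<beta>\<^sub>0"
    unfolding span_columns_eq_model_mult by metis
  have arg: "is_arg_min card (\<lambda>\<tau>. \<exists>\<beta>. model_mult X \<tau> \<beta> = model_mult X \<tau>\<^sub>0 \<beta>\<^sub>0) \<tau>' \<longleftrightarrow> \<tau>' = \<tau>\<^sub>0" for \<tau>'
    using assms(1) by (auto simp: identifiable_def)
  have "is_arg_min card (\<lambda>\<tau>. \<exists>\<beta>. model_mult X \<tau> \<beta> = model_mult X \<tau>\<^sub>0 \<beta>\<^sub>0) \<tau>"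
    using arg[of \<tau>\<^sub>0] ex assms(3) unfolding is_arg_min_def by (meson order_less_le_trans)
  with arg assms(2) show False by blast
qed

text \<open>If the columns were dependent, a basis chosen among them would represent the mean by a
  smaller model. The degrees of freedom of the statistic are thus true dimensions.\<close>

lemma identifiable_dim_span:
  assumes "identifiable X \<tau>\<^sub>0 \<beta>\<^sub>0"
  shows "dim (span ((\<lambda>i. column i X) ` \<tau>\<^sub>0)) = card \<tau>\<^sub>0"
proof (rule ccontr)
  let ?c = "\<lambda>i. column i X"
  assume ne: "dim (span (?c ` \<tau>\<^sub>0)) \<noteq> card \<tau>\<^sub>0"
  obtain B where B: "B \<subseteq> ?c ` \<tau>\<^sub>0" "independent B" "?c ` \<tau>\<^sub>0 \<subseteq> span B" "card B = dim (?c ` \<tau>\<^sub>0)"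
    using basis_exists[of "?c ` \<tau>\<^sub>0"] by blast
  have "dim (?c ` \<tau>\<^sub>0) \<le> card (?c ` \<tau>\<^sub>0)" by (rule dim_le_card') simp
  also have "\<dots> \<le> card \<tau>\<^sub>0" by (rule card_image_le) simp
  finally have lt: "card B < card \<tau>\<^sub>0" using B(4) ne by simp
  \<comment> \<open>Columns may coincide, so \<open>\<tau>\<close> takes exactly one index per basis
    vector.\<close>
  obtain \<tau> where \<tau>: "\<tau> \<subseteq> \<tau>\<^sub>0" "inj_on ?c \<tau>" "B = ?c ` \<tau>"
    using B(1) subset_image_inj by metis
  have "card \<tau> = card B" using \<tau> by (simp add: card_image)
  moreover have "model_mult X \<tau>\<^sub>0 \<beta>\<^sub>0 \<in> span (?c ` \<tau>)"
    using model_mult_in_span[of X \<tau>\<^sub>0 \<beta>\<^sub>0] span_mono[OF B(3)] \<tau>(3) by (auto simp: span_span)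
  ultimately show False
    using identifiable_not_in_span[OF assms, of \<tau>] lt by fastforce
qed

text \<open>For the dimension, the upper bound counts generators; the lower bound holds because
  \<open>A\<close> and the columns of \<open>\<tau> - \<Lambda>\<close> together span all columns of
  \<open>\<tau>\<close>.\<close>

lemma O_mat_range:
  fixes X :: "real^'p^'n" and \<tau> \<Lambda> :: "'p set"
  defines "A \<equiv> span ((\<lambda>i. (mat 1 - H_mat X (\<tau> - \<Lambda>)) *v column i X) ` (\<Lambda> \<inter> \<tau>))"
  shows "A \<subseteq> span ((\<lambda>i. column i X) ` \<tau>)"
    and "a \<in> A \<Longrightarrow> v \<in> span ((\<lambda>i. column i X) ` (\<tau> - \<Lambda>)) \<Longrightarrow> orthogonal a v"
    and "dim (span ((\<lambda>i. column i X) ` \<tau>)) = card \<tau> \<Longrightarrow> dim A = card (\<Lambda> \<inter> \<tau>)"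
proof -
  let ?c = "\<lambda>i. column i X"
  let ?V = "span (?c ` \<tau>)" and ?V1 = "span (?c ` (\<tau> - \<Lambda>))"
  let ?d = "\<lambda>i. (mat 1 - H_mat X (\<tau> - \<Lambda>)) *v ?c i"
  have H: "H_mat X (\<tau> - \<Lambda>) *v x \<in> ?V1" for x
    unfolding H_mat_def by (rule orth_proj_mat_props) simp
  have d: "?d i = ?c i - H_mat X (\<tau> - \<Lambda>) *v ?c i" for i
    by (simp add: matrix_vector_mult_diff_rdistrib)
  have V1V: "?V1 \<subseteq> ?V" by (intro span_mono) auto
  have "?d i \<in> ?V" if "i \<in> \<Lambda> \<inter> \<tau>" for i
    using that H[of "?c i"] V1V unfolding d by (intro span_diff) (auto intro: span_base)
  then show "A \<subseteq> ?V" unfolding A_def by (intro span_minimal) auto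
  show "orthogonal a v" if "a \<in> A" "v \<in> ?V1"
  proof -
    have dv: "orthogonal v (?d i)" for i
      using orth_proj_mat_props(2)[of ?V1 v "?c i"] that(2) d[of i] unfolding H_mat_def
      by (simp add: orthogonal_def inner_commute)
    have "orthogonal v a"
    proof (rule orthogonal_to_span[OF that(1)[unfolded A_def]])
      fix y assume "y \<in> ?d ` (\<Lambda> \<inter> \<tau>)"
      then show "orthogonal v y" using dv by blast
    qed
    then show ?thesis by (simp add: orthogonal_commute)
  qed
  show "dim A = card (\<Lambda> \<inter> \<tau>)" if dim: "dim ?V = card \<tau>"
  proof (rule antisym)
    have "dim A \<le> card (?d ` (\<Lambda> \<inter> \<tau>))" unfolding A_def by (simp add: dim_le_card')
    also have "\<dots> \<le> card (\<Lambda> \<inter> \<tau>)" by (rule card_image_le) simp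
    finally show "dim A \<le> card (\<Lambda> \<inter> \<tau>)" .
    obtain B where B: "B \<subseteq> A" "independent B" "A \<subseteq> span B" "card B = dim A"
      using basis_exists[of A] by blast
    let ?W = "B \<union> ?c ` (\<tau> - \<Lambda>)"
    have "?c i \<in> span ?W" if "i \<in> \<tau>" for i
    proof (cases "i \<in> \<Lambda>")
      case True
      \<comment> \<open>A column in \<Lambda> is its component in \<open>A\<close> plus its
        projection onto the span of the columns of \<open>\<tau> - \<Lambda>\<close>.\<close>
      have "?d i \<in> span ?W"
        using that True B(3) span_mono[of B ?W] unfolding A_def by (auto intro: span_base)
      moreover have "H_mat X (\<tau> - \<Lambda>) *v ?c i \<in> span ?W"
        using H[of "?c i"] span_mono[of "?c ` (\<tau> - \<Lambda>)" ?W] by auto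
      ultimately have "?d i + H_mat X (\<tau> - \<Lambda>) *v ?c i \<in> span ?W" by (rule span_add)
      then show ?thesis unfolding d by simp
    qed (use that in \<open>auto intro: span_base\<close>)
    then have "?V \<subseteq> span ?W" by (intro span_minimal) auto
    moreover have "finite ?W" using B(2) by (auto intro: independent_imp_finite)
    ultimately have "dim ?V \<le> card ?W" by (rule dim_le_card)
    also have "\<dots> \<le> card B + card (?c ` (\<tau> - \<Lambda>))" by (rule card_Un_le)
    also have "\<dots> \<le> dim A + card (\<tau> - \<Lambda>)" using B(4) by (simp add: card_image_le)
    finally have "card \<tau> \<le> dim A + card (\<tau> - \<Lambda>)" using dim by simp
    moreover have "card \<tau> = card (\<Lambda> \<inter> \<tau>) + card (\<tau> - \<Lambda>)"
      by (subst card_Un_disjoint[symmetric]) (auto intro: arg_cong[where f = card])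
    ultimately show "card (\<Lambda> \<inter> \<tau>) \<le> dim A" by simp
  qed
qed

text \<open>At the true coefficients both quadratic forms depend on the noise only and the scale
  cancels, which leaves the exact \<open>F\<close> law. If \<Lambda> misses
  \<open>\<tau>\<^sub>0\<close>, the statistic is 0 and coverage is certain.\<close>

lemma T_stat_coverage:
  fixes X :: "real^'p^'n"
  assumes id: "identifiable X \<tau>\<^sub>0 \<beta>\<^sub>0" and \<sigma>: "\<sigma>\<^sub>0 > 0" and \<alpha>: "0 < \<alpha>" "\<alpha> < 1"
    and n: "card \<tau>\<^sub>0 < CARD('n)"
  shows "\<alpha> \<le> measure std_normal_vec
    {u. T_stat X \<Lambda> (response X \<tau>\<^sub>0 \<beta>\<^sub>0 \<sigma>\<^sub>0 u) (restrict (full_coeff \<tau>\<^sub>0 \<beta>\<^sub>0) \<Lambda>) \<tau>\<^sub>0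
        \<in> B_set CARD('n) \<alpha> \<Lambda> \<tau>\<^sub>0}"
proof -
  interpret prob_space "std_normal_vec :: (real^'n) measure" by (rule prob_space_std_normal_vec)
  let ?\<beta> = "restrict (full_coeff \<tau>\<^sub>0 \<beta>\<^sub>0) \<Lambda>"
  have nz: "\<not> (\<exists>i\<in>\<Lambda> - \<tau>\<^sub>0. ?\<beta> i \<noteq> 0)" by (auto simp: full_coeff_def)
  show ?thesis
  proof (cases "\<Lambda> \<inter> \<tau>\<^sub>0 = {}")
    case True
    then show ?thesis using nz \<alpha> prob_space by (simp add: T_stat_def B_set_def Let_def)
  next
    case False
    let ?c = "\<lambda>i. column i X"
    define A where "A = span ((\<lambda>i. (mat 1 - H_mat X (\<tau>\<^sub>0 - \<Lambda>)) *v ?c i) ` (\<Lambda> \<inter> \<tau>\<^sub>0))"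
    define V where "V = span (?c ` \<tau>\<^sub>0)"
    define C where "C = {y. \<forall>s\<in>V. orthogonal s y}"
    define m where "m = CARD('n) - card \<tau>\<^sub>0"
    have sA: "subspace A" and sV: "subspace V" by (simp_all add: A_def V_def)
    have sC: "subspace C" by (auto simp: C_def subspace_def orthogonal_def inner_simps)
    have dV: "dim V = card \<tau>\<^sub>0" unfolding V_def by (rule identifiable_dim_span[OF id])
    have AV: "A \<subseteq> V" unfolding A_def V_def by (rule O_mat_range)
    have dA: "dim A = card (\<Lambda> \<inter> \<tau>\<^sub>0)"
      using dV unfolding A_def V_def by (rule O_mat_range)
    have "dim {y \<in> UNIV. \<forall>x\<in>V. orthogonal x y} + dim V = dim (UNIV :: (real^'n) set)"
      using sV by (intro dim_subspace_orthogonal_to_vectors) auto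
    then have dC: "dim C = m" using dV by (simp add: C_def m_def)
    have AC: "orthogonal a c" if "a \<in> A" "c \<in> C" for a c
      using that AV by (auto simp: C_def)
    have O: "O_mat X \<tau>\<^sub>0 \<Lambda> = orth_proj_mat A" by (simp add: O_mat_def A_def)
    have IH: "(mat 1 - H_mat X \<tau>\<^sub>0) *v x = orth_proj_mat C *v x" for x
      unfolding H_mat_def V_def[symmetric] C_def by (rule orth_proj_mat_orthogonal_complement[OF sV])
    \<comment> \<open>\<open>w\<close> is the nuisance part of the mean, from columns outside
      \<Lambda>. It lies in \<open>V\<close> and is orthogonal to \<open>A\<close>, so both
      projections annihilate it.\<close>
    define w where "w = model_mult X (\<tau>\<^sub>0 - \<Lambda>) \<beta>\<^sub>0"
    have wV1: "w \<in> span (?c ` (\<tau>\<^sub>0 - \<Lambda>))" unfolding w_def by (rule model_mult_in_span)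
    then have wV: "w \<in> V" using span_mono[of "?c ` (\<tau>\<^sub>0 - \<Lambda>)" "?c ` \<tau>\<^sub>0"] by (auto simp: V_def)
    have Ow: "orth_proj_mat A *v w = 0"
      using O_mat_range(2)[OF _ wV1] by (intro orth_proj_mat_eqI[OF sA])
        (auto simp: A_def span_zero orthogonal_def inner_commute)
    have Cw: "orth_proj_mat C *v w = 0"
      using wV by (intro orth_proj_mat_eqI[OF sC]) (auto simp: subspace_0[OF sC] C_def orthogonal_def)
    have m\<Lambda>: "model_mult X \<Lambda> ?\<beta> = model_mult X (\<Lambda> \<inter> \<tau>\<^sub>0) \<beta>\<^sub>0"
      unfolding model_mult_def
      by (rule sum.mono_neutral_cong_right) (auto simp: full_coeff_def)
    have "model_mult X \<tau>\<^sub>0 \<beta>\<^sub>0 = model_mult X (\<Lambda> \<inter> \<tau>\<^sub>0) \<beta>\<^sub>0 + w"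
      unfolding w_def model_mult_def
      by (subst sum.union_disjoint[symmetric]) (auto intro: sum.cong)
    then have r: "response X \<tau>\<^sub>0 \<beta>\<^sub>0 \<sigma>\<^sub>0 u - model_mult X \<Lambda> ?\<beta> = w + \<sigma>\<^sub>0 *\<^sub>R u" for u
      by (simp add: response_def m\<Lambda>)
    have nAr: "(w + \<sigma>\<^sub>0 *\<^sub>R u) \<bullet> (orth_proj_mat A *v (w + \<sigma>\<^sub>0 *\<^sub>R u)) = \<sigma>\<^sub>0\<^sup>2 * (norm (orth_proj_mat A *v u))\<^sup>2"
      and nCr: "(w + \<sigma>\<^sub>0 *\<^sub>R u) \<bullet> (orth_proj_mat C *v (w + \<sigma>\<^sub>0 *\<^sub>R u)) = \<sigma>\<^sub>0\<^sup>2 * (norm (orth_proj_mat C *v u))\<^sup>2" for u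
      unfolding inner_orth_proj_mat[OF sA] inner_orth_proj_mat[OF sC]
      by (simp_all add: matrix_vector_right_distrib matrix_vector_mult_scaleR Ow Cw power_mult_distrib)
    \<comment> \<open>Here the factor \<open>\<sigma>\<^sub>0\<^sup>2\<close> cancels and the
      cardinalities become the dimensions of \<open>A\<close> and \<open>C\<close>.\<close>
    have "T_stat X \<Lambda> (response X \<tau>\<^sub>0 \<beta>\<^sub>0 \<sigma>\<^sub>0 u) ?\<beta> \<tau>\<^sub>0 =
        ereal (((norm (orth_proj_mat A *v u))\<^sup>2 / real (dim A)) / ((norm (orth_proj_mat C *v u))\<^sup>2 / real (dim C)))" for u
      using nz False \<sigma> n unfolding T_stat_def Let_def r O IH nAr nCr dA dC m_def
      by (simp add: of_nat_diff)
    moreover have "B_set CARD('n) \<alpha> \<Lambda> \<tau>\<^sub>0 = {0 .. ereal (F_quantile (dim A) (dim C) \<alpha>)}"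
      using False n by (simp add: B_set_def dA dC m_def)
    ultimately have "{u. T_stat X \<Lambda> (response X \<tau>\<^sub>0 \<beta>\<^sub>0 \<sigma>\<^sub>0 u) ?\<beta> \<tau>\<^sub>0 \<in> B_set CARD('n) \<alpha> \<Lambda> \<tau>\<^sub>0} =
      {u. ((norm (orth_proj_mat A *v u))\<^sup>2 / real (dim A)) / ((norm (orth_proj_mat C *v u))\<^sup>2 / real (dim C))
        \<le> F_quantile (dim A) (dim C) \<alpha>}"
      by simp
    then show ?thesis using std_normal_vec_F_quantile[OF sA sC AC \<alpha>] by simp
  qed
qed

section \<open>Recovery of the true model\<close>

lemma penalized_loss_le:
  "penalized_loss X lam y u \<tau> \<le> (norm (y - model_mult X \<tau> \<beta> - \<sigma> *\<^sub>R u))\<^sup>2 + lam * real (card \<tau>)"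
proof -
  have "bdd_below (range (\<lambda>(\<beta>, \<sigma>). (norm (y - model_mult X \<tau> \<beta> - \<sigma> *\<^sub>R u))\<^sup>2 + lam * real (card \<tau>)))"
    by (rule bdd_belowI[of _ "lam * real (card \<tau>)"]) auto
  from cINF_lower[OF this, of "(\<beta>, \<sigma>)"] show ?thesis
    unfolding penalized_loss_def by simp
qed

lemma penalized_loss_ge:
  assumes "\<And>\<beta> \<sigma>. c \<le> (norm (y - model_mult X \<tau> \<beta> - \<sigma> *\<^sub>R u))\<^sup>2"
  shows "c + lam * real (card \<tau>) \<le> penalized_loss X lam y u \<tau>"
  unfolding penalized_loss_def by (rule cINF_greatest) (use assms in auto)

section \<open>Residuals and Gram determinants\<close>

definition residual :: "real^'p^'n \<Rightarrow> 'p set \<Rightarrow> real^'n \<Rightarrow> real^'n" where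
  "residual X \<tau> x = x - H_mat X \<tau> *v x"

text \<open>The Gram determinant of the two residuals, polynomial in \<open>a\<close> and
  \<open>b\<close>. Unlike the distance obtained from it by division, it stays continuous where a
  residual vanishes, which keeps the sets defined below open.\<close>

definition residual_gram :: "real^'p^'n \<Rightarrow> 'p set \<Rightarrow> real^'n \<Rightarrow> real^'n \<Rightarrow> real" where
  "residual_gram X \<tau> a b =
     (norm (residual X \<tau> a))\<^sup>2 * (norm (residual X \<tau> b))\<^sup>2 - (residual X \<tau> a \<bullet> residual X \<tau> b)\<^sup>2"

lemma linear_residual: "linear (residual X \<tau>)"
  unfolding residual_def
  by (intro linear_compose_sub matrix_vector_mul_linear linear_id[unfolded id_def])

lemma continuous_on_residual [continuous_intros]:
  "continuous_on S f \<Longrightarrow> continuous_on S (\<lambda>x. residual X \<tau> (f x))"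
  unfolding residual_def
  by (intro continuous_intros continuous_on_compose2[OF matrix_vector_mult_linear_continuous_on[of UNIV]]) auto

lemma continuous_on_residual_gram [continuous_intros]:
  "continuous_on S f \<Longrightarrow> continuous_on S g \<Longrightarrow> continuous_on S (\<lambda>x. residual_gram X \<tau> (f x) (g x))"
  unfolding residual_gram_def by (intro continuous_intros)

lemma residual_eq_0:
  assumes "x \<in> span ((\<lambda>i. column i X) ` \<tau>)"
  shows "residual X \<tau> x = 0"
proof -
  have "H_mat X \<tau> *v x = x"
    unfolding H_mat_def by (rule orth_proj_mat_eqI) (use assms in auto)
  then show ?thesis by (simp add: residual_def)
qed

lemma norm_residual_le: "norm (residual X \<tau> x) \<le> norm x"
proof -
  let ?h = "H_mat X \<tau> *v x"
  have "residual X \<tau> x \<bullet> ?h = 0"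
    unfolding residual_def H_mat_def
    by (rule orth_proj_mat_props(2)[OF subspace_span orth_proj_mat_props(1)[OF subspace_span]])
  then have "orthogonal (residual X \<tau> x) ?h" by (simp add: orthogonal_def)
  then have "(norm (residual X \<tau> x + ?h))\<^sup>2 = (norm (residual X \<tau> x))\<^sup>2 + (norm ?h)\<^sup>2"
    by (rule norm_add_Pythagorean)
  then have "(norm (residual X \<tau> x))\<^sup>2 \<le> (norm x)\<^sup>2" by (simp add: residual_def)
  then show ?thesis by (rule power2_le_imp_le) simp
qed

text \<open>A Gram determinant does not change when a multiple of one vector is added to the other.
  This replaces the response by its mean when the repro sample equals the noise.\<close>

lemma residual_gram_add:
  "residual_gram X \<tau> (a + c *\<^sub>R b) b = residual_gram X \<tau> a b"
proof -
  have "residual X \<tau> (a + c *\<^sub>R b) = residual X \<tau> a + c *\<^sub>R residual X \<tau> b"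
    by (simp add: linear_add[OF linear_residual] linear_cmul[OF linear_residual])
  then show ?thesis
    unfolding residual_gram_def power2_norm_eq_inner
    by (simp add: inner_add_left inner_add_right inner_commute power2_eq_square algebra_simps)
qed

text \<open>Vanishing is the equality case of Cauchy-Schwarz: the residual of \<open>b\<close> would
  be a multiple of that of \<open>a\<close>, placing \<open>b\<close> in the excluded span.\<close>

lemma residual_gram_pos:
  assumes "a \<notin> span ((\<lambda>i. column i X) ` \<tau>)" and "b \<notin> span (insert a ((\<lambda>i. column i X) ` \<tau>))"
  shows "residual_gram X \<tau> a b > 0"
proof -
  let ?S = "(\<lambda>i. column i X) ` \<tau>"
  let ?a = "residual X \<tau> a" and ?b = "residual X \<tau> b"
  have H: "H_mat X \<tau> *v x \<in> span ?S" for x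
    unfolding H_mat_def by (rule orth_proj_mat_props) simp
  have a0: "?a \<noteq> 0" using assms(1) H[of a] by (auto simp: residual_def)
  have ge: "(?a \<bullet> ?b)\<^sup>2 \<le> (norm ?a)\<^sup>2 * (norm ?b)\<^sup>2"
    using Cauchy_Schwarz_ineq[of ?a ?b] by (simp add: power2_norm_eq_inner)
  have "(?a \<bullet> ?b)\<^sup>2 \<noteq> (norm ?a)\<^sup>2 * (norm ?b)\<^sup>2"
  proof
    assume eq: "(?a \<bullet> ?b)\<^sup>2 = (norm ?a)\<^sup>2 * (norm ?b)\<^sup>2"
    \<comment> \<open>The coefficient of the projection of \<open>?b\<close> onto \<open>?a\<close>;
      equality forces the remainder to be zero.\<close>
    let ?c = "(?a \<bullet> ?b) / (?a \<bullet> ?a)"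
    have pa: "?a \<bullet> ?a > 0" using a0 by simp
    have "(?b - ?c *\<^sub>R ?a) \<bullet> (?b - ?c *\<^sub>R ?a) = ?b \<bullet> ?b - (?a \<bullet> ?b)\<^sup>2 / (?a \<bullet> ?a)"
      using pa by (simp add: inner_diff_left inner_diff_right inner_commute power2_eq_square field_simps)
    also have "\<dots> = 0" using eq pa by (simp add: power2_norm_eq_inner)
    finally have "?b = ?c *\<^sub>R ?a" by simp
    then have b: "b = H_mat X \<tau> *v b + ?c *\<^sub>R (a - H_mat X \<tau> *v a)"
      by (simp add: residual_def algebra_simps)
    have "span ?S \<subseteq> span (insert a ?S)" by (rule span_mono) auto
    then have "H_mat X \<tau> *v b + ?c *\<^sub>R (a - H_mat X \<tau> *v a) \<in> span (insert a ?S)"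
      using H by (intro span_add span_scale span_diff) (auto intro: span_base)
    with b assms(2) show False by simp
  qed
  then show ?thesis using ge by (simp add: residual_gram_def)
qed

text \<open>The squared distance from \<open>y\<close> to the span of \<open>X\<^sub>\<tau>\<close> and \<open>u\<close> is the Gram determinant
  divided by the squared norm of the residual of \<open>u\<close>.\<close>

lemma residual_gram_lower_bound:
  assumes "\<kappa> * (norm (residual X \<tau> u))\<^sup>2 < residual_gram X \<tau> y u"
  shows "\<kappa> \<le> (norm (y - model_mult X \<tau> \<beta> - \<sigma> *\<^sub>R u))\<^sup>2"
proof -
  let ?y = "residual X \<tau> y" and ?u = "residual X \<tau> u"
  \<comment> \<open>If the residual of \<open>u\<close> vanished, both sides of the assumption would
    be 0.\<close>
  have u: "norm ?u \<noteq> 0" using assms by (auto simp: residual_gram_def)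
  have "residual X \<tau> (y - model_mult X \<tau> \<beta> - \<sigma> *\<^sub>R u) = ?y - \<sigma> *\<^sub>R ?u"
    by (simp add: linear_diff[OF linear_residual] linear_cmul[OF linear_residual]
        residual_eq_0[OF model_mult_in_span])
  then have le: "(norm (?y - \<sigma> *\<^sub>R ?u))\<^sup>2 \<le> (norm (y - model_mult X \<tau> \<beta> - \<sigma> *\<^sub>R u))\<^sup>2"
    using norm_residual_le[of X \<tau> "y - model_mult X \<tau> \<beta> - \<sigma> *\<^sub>R u"] by (simp add: power_mono)
  \<comment> \<open>The gap is a perfect square in \<sigma>, zero at the least-squares
    scale.\<close>
  have "(norm (?y - \<sigma> *\<^sub>R ?u))\<^sup>2 * (norm ?u)\<^sup>2 - residual_gram X \<tau> y u = (?y \<bullet> ?u - \<sigma> * (?u \<bullet> ?u))\<^sup>2"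
    unfolding residual_gram_def power2_norm_eq_inner
    by (simp add: inner_diff_left inner_diff_right inner_commute power2_eq_square algebra_simps)
  then have "residual_gram X \<tau> y u \<le> (norm (?y - \<sigma> *\<^sub>R ?u))\<^sup>2 * (norm ?u)\<^sup>2"
    by (smt (verit) zero_le_power2)
  then have "\<kappa> * (norm ?u)\<^sup>2 \<le> (norm (?y - \<sigma> *\<^sub>R ?u))\<^sup>2 * (norm ?u)\<^sup>2" using assms by linarith
  then have "\<kappa> \<le> (norm (?y - \<sigma> *\<^sub>R ?u))\<^sup>2" using u by simp
  with le show ?thesis by linarith
qed

text \<open>Noise for which the mean has squared distance above \<kappa> from the span of
  \<open>u\<close> and the columns of each competing model of at most the true size. The denominator
  is multiplied out, and strict inequality makes the set open.\<close>

definition separated_noise :: "real^'p^'n \<Rightarrow> 'p set \<Rightarrow> ('p \<Rightarrow> real) \<Rightarrow> real \<Rightarrow> (real^'n) set" where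
  "separated_noise X \<tau>\<^sub>0 \<beta>\<^sub>0 \<kappa> = {u. \<forall>\<tau>. \<tau> \<noteq> \<tau>\<^sub>0 \<and> card \<tau> \<le> card \<tau>\<^sub>0 \<longrightarrow>
     \<kappa> * (norm (residual X \<tau> u))\<^sup>2 < residual_gram X \<tau> (model_mult X \<tau>\<^sub>0 \<beta>\<^sub>0) u}"

text \<open>Pairs of noise and repro sample. Of the two bounds under \<open>min\<close>,
  \<open>lam\<close> defeats larger models and
  \<open>\<kappa> - lam * real (card \<tau>\<^sub>0)\<close> the others.\<close>

definition recovery_region ::
    "real^'p^'n \<Rightarrow> 'p set \<Rightarrow> ('p \<Rightarrow> real) \<Rightarrow> real \<Rightarrow> real \<Rightarrow> real \<Rightarrow> ((real^'n) \<times> (real^'n)) set" where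
  "recovery_region X \<tau>\<^sub>0 \<beta>\<^sub>0 \<sigma>\<^sub>0 lam \<kappa> =
     {(u, v). \<sigma>\<^sub>0\<^sup>2 * (norm (u - v))\<^sup>2 < min lam (\<kappa> - lam * real (card \<tau>\<^sub>0)) \<and>
       (\<forall>\<tau>. \<tau> \<noteq> \<tau>\<^sub>0 \<and> card \<tau> \<le> card \<tau>\<^sub>0 \<longrightarrow>
         \<kappa> * (norm (residual X \<tau> v))\<^sup>2 < residual_gram X \<tau> (response X \<tau>\<^sub>0 \<beta>\<^sub>0 \<sigma>\<^sub>0 u) v)}"

lemma open_separated_noise: "open (separated_noise X \<tau>\<^sub>0 \<beta>\<^sub>0 \<kappa>)"
proof -
  have "separated_noise X \<tau>\<^sub>0 \<beta>\<^sub>0 \<kappa> = (\<Inter>\<tau>\<in>{\<tau>. \<tau> \<noteq> \<tau>\<^sub>0 \<and> card \<tau> \<le> card \<tau>\<^sub>0}.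
      {u. \<kappa> * (norm (residual X \<tau> u))\<^sup>2 < residual_gram X \<tau> (model_mult X \<tau>\<^sub>0 \<beta>\<^sub>0) u})"
    by (auto simp: separated_noise_def)
  then show ?thesis
    by (auto intro!: open_INT open_Collect_less continuous_intros)
qed

lemma open_recovery_region: "open (recovery_region X \<tau>\<^sub>0 \<beta>\<^sub>0 \<sigma>\<^sub>0 lam \<kappa>)"
proof -
  have "recovery_region X \<tau>\<^sub>0 \<beta>\<^sub>0 \<sigma>\<^sub>0 lam \<kappa> =
      {p. \<sigma>\<^sub>0\<^sup>2 * (norm (fst p - snd p))\<^sup>2 < min lam (\<kappa> - lam * real (card \<tau>\<^sub>0))} \<inter>
      (\<Inter>\<tau>\<in>{\<tau>. \<tau> \<noteq> \<tau>\<^sub>0 \<and> card \<tau> \<le> card \<tau>\<^sub>0}.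
        {p. \<kappa> * (norm (residual X \<tau> (snd p)))\<^sup>2 < residual_gram X \<tau> (response X \<tau>\<^sub>0 \<beta>\<^sub>0 \<sigma>\<^sub>0 (fst p)) (snd p)})"
    by (auto simp: recovery_region_def)
  then show ?thesis
    by (simp only: response_def) (intro open_Int open_INT ballI open_Collect_less continuous_intros, simp)
qed

lemma recovery_region_diagonal:
  assumes "u \<in> separated_noise X \<tau>\<^sub>0 \<beta>\<^sub>0 \<kappa>" "lam > 0" "lam * real (card \<tau>\<^sub>0) < \<kappa>"
  shows "(u, u) \<in> recovery_region X \<tau>\<^sub>0 \<beta>\<^sub>0 \<sigma>\<^sub>0 lam \<kappa>"
  using assms by (simp add: recovery_region_def separated_noise_def response_def residual_gram_add)

lemma tau_hat_recovery:
  fixes tie :: "'p::finite set set \<Rightarrow> 'p set"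
  assumes uv: "(u, v) \<in> recovery_region X \<tau>\<^sub>0 \<beta>\<^sub>0 \<sigma>\<^sub>0 lam \<kappa>" and lam: "lam > 0"
    and tie: "\<And>A. A \<noteq> {} \<Longrightarrow> tie A \<in> A"
  shows "tau_hat tie X lam (response X \<tau>\<^sub>0 \<beta>\<^sub>0 \<sigma>\<^sub>0 u) v = \<tau>\<^sub>0"
proof -
  let ?y = "response X \<tau>\<^sub>0 \<beta>\<^sub>0 \<sigma>\<^sub>0 u"
  let ?L = "penalized_loss X lam ?y v"
  let ?s = "\<sigma>\<^sub>0\<^sup>2 * (norm (u - v))\<^sup>2"
  \<comment> \<open>At the true coefficients and scale only the gap between noise and repro sample
    remains in the loss.\<close>
  have "?y - model_mult X \<tau>\<^sub>0 \<beta>\<^sub>0 - \<sigma>\<^sub>0 *\<^sub>R v = \<sigma>\<^sub>0 *\<^sub>R (u - v)"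
    by (simp add: response_def algebra_simps)
  then have up: "?L \<tau>\<^sub>0 \<le> ?s + lam * real (card \<tau>\<^sub>0)"
    using penalized_loss_le[of X lam ?y v \<tau>\<^sub>0 \<beta>\<^sub>0 \<sigma>\<^sub>0] by (simp add: power_mult_distrib)
  have s: "?s < lam" "?s + lam * real (card \<tau>\<^sub>0) < \<kappa>"
    using uv by (auto simp: recovery_region_def)
  have less: "?L \<tau>\<^sub>0 < ?L \<tau>" if "\<tau> \<noteq> \<tau>\<^sub>0" for \<tau>
  proof (cases "card \<tau> \<le> card \<tau>\<^sub>0")
    case True
    have "\<kappa> + lam * real (card \<tau>) \<le> ?L \<tau>"
      using uv True that
      by (intro penalized_loss_ge residual_gram_lower_bound) (auto simp: recovery_region_def)
    moreover have "0 \<le> lam * real (card \<tau>)" using lam by simp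
    ultimately show ?thesis using up s by linarith
  next
    case False
    have "0 + lam * real (card \<tau>) \<le> ?L \<tau>" by (rule penalized_loss_ge) simp
    \<comment> \<open>A larger model pays at least one more unit of penalty, and
      \<open>?s < lam\<close> stays below that unit.\<close>
    moreover have "lam * (real (card \<tau>\<^sub>0) + 1) \<le> lam * real (card \<tau>)"
      using False lam by (intro mult_left_mono) auto
    ultimately show ?thesis using up s by (simp add: distrib_left)
  qed
  have "{\<tau>. is_arg_min ?L (\<lambda>_. True) \<tau>} = {\<tau>\<^sub>0}"
  proof (intro equalityI subsetI)
    fix \<tau> assume "\<tau> \<in> {\<tau>. is_arg_min ?L (\<lambda>_. True) \<tau>}"
    then show "\<tau> \<in> {\<tau>\<^sub>0}" using less[of \<tau>] by (auto simp: is_arg_min_def)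
  next
    fix \<tau> assume "\<tau> \<in> {\<tau>\<^sub>0}"
    moreover have "\<not> ?L \<tau>' < ?L \<tau>\<^sub>0" for \<tau>'
      using less[of \<tau>'] by (cases "\<tau>' = \<tau>\<^sub>0") auto
    ultimately show "\<tau> \<in> {\<tau>. is_arg_min ?L (\<lambda>_. True) \<tau>}" by (simp add: is_arg_min_def)
  qed
  then show ?thesis using tie[of "{\<tau>\<^sub>0}"] by (simp add: tau_hat_def)
qed

text \<open>Noise is separated for some \<open>k\<close> once it avoids the finitely many subspaces
  \<open>?S \<tau>\<close>. Their dimension is at most \<open>card \<tau>\<^sub>0 + 1\<close>, below
  that of the space, so they are null.\<close>

lemma prob_UN_separated_noise:
  fixes X :: "real^'p^'n"
  assumes id: "identifiable X \<tau>\<^sub>0 \<beta>\<^sub>0" and n: "card \<tau>\<^sub>0 + 1 < CARD('n)"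
  shows "measure std_normal_vec (\<Union>k. separated_noise X \<tau>\<^sub>0 \<beta>\<^sub>0 (1 / real (Suc k))) = 1"
proof -
  interpret prob_space "std_normal_vec :: (real^'n) measure" by (rule prob_space_std_normal_vec)
  let ?m = "model_mult X \<tau>\<^sub>0 \<beta>\<^sub>0"
  let ?T = "{\<tau>. \<tau> \<noteq> \<tau>\<^sub>0 \<and> card \<tau> \<le> card \<tau>\<^sub>0}"
  let ?S = "\<lambda>\<tau>. span (insert ?m ((\<lambda>i. column i X) ` \<tau>))"
  let ?G = "\<lambda>k. separated_noise X \<tau>\<^sub>0 \<beta>\<^sub>0 (1 / real (Suc k))"
  have null: "?S \<tau> \<in> null_sets std_normal_vec" if \<tau>: "\<tau> \<in> ?T" for \<tau>
  proof -
    have "dim (?S \<tau>) \<le> card (insert ?m ((\<lambda>i. column i X) ` \<tau>))"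
      by (simp add: dim_le_card')
    also have "\<dots> \<le> Suc (card ((\<lambda>i. column i X) ` \<tau>))" by (rule card_insert_le_m1) auto
    also have "\<dots> \<le> Suc (card \<tau>)" by (simp add: card_image_le)
    also have "\<dots> < DIM(real^'n)" using \<tau> n by simp
    finally have "negligible (?S \<tau>)" by (rule negligible_lowdim)
    moreover have "?S \<tau> \<in> sets borel" by (intro borel_closed closed_subspace subspace_span)
    ultimately show ?thesis by (intro null_setsI std_normal_vec_negligible) auto
  qed
  have "AE u in std_normal_vec. \<forall>\<tau>\<in>?T. u \<notin> ?S \<tau>"
    by (rule AE_finite_allI) (auto intro: AE_not_in null)
  then have "AE u in std_normal_vec. u \<in> (\<Union>k. ?G k)"
  proof eventually_elim
    case (elim u)
    have pos: "residual_gram X \<tau> ?m u > 0" if "\<tau> \<in> ?T" for \<tau>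
      using that elim identifiable_not_in_span[OF id] by (intro residual_gram_pos) auto
    \<comment> \<open>There are finitely many models, so one \<open>k\<close> serves them
      all.\<close>
    have "eventually (\<lambda>k. \<forall>\<tau>\<in>?T. 1 / real (Suc k) * (norm (residual X \<tau> u))\<^sup>2 < residual_gram X \<tau> ?m u) sequentially"
    proof (intro eventually_ball_finite ballI)
      fix \<tau> assume \<tau>: "\<tau> \<in> ?T"
      have "(\<lambda>k. 1 / real (Suc k) * (norm (residual X \<tau> u))\<^sup>2) \<longlonglongrightarrow> 0"
        by (intro tendsto_mult_left_zero LIMSEQ_inverse_real_of_nat[unfolded inverse_eq_divide])
      then show "eventually (\<lambda>k. 1 / real (Suc k) * (norm (residual X \<tau> u))\<^sup>2 < residual_gram X \<tau> ?m u) sequentially"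
        using pos[OF \<tau>] by (rule order_tendstoD)
    qed simp
    then obtain k where "\<forall>\<tau>\<in>?T. 1 / real (Suc k) * (norm (residual X \<tau> u))\<^sup>2 < residual_gram X \<tau> ?m u"
      by (auto simp: eventually_sequentially)
    then show ?case by (auto simp: separated_noise_def intro!: exI[of _ k])
  qed
  then show ?thesis
    by (subst prob_eq_1) (auto intro!: borel_open open_UN open_separated_noise)
qed

text \<open>Continuity from below: the sets grow as \<kappa> decreases along
  \<open>1 / real (Suc k)\<close>.\<close>

lemma ex_separated_noise_prob:
  fixes X :: "real^'p^'n"
  assumes id: "identifiable X \<tau>\<^sub>0 \<beta>\<^sub>0" and n: "card \<tau>\<^sub>0 + 1 < CARD('n)" and \<delta>: "\<delta> > 0"
  shows "\<exists>\<kappa>>0. measure std_normal_vec (separated_noise X \<tau>\<^sub>0 \<beta>\<^sub>0 \<kappa>) > 1 - \<delta>"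
proof -
  interpret prob_space "std_normal_vec :: (real^'n) measure" by (rule prob_space_std_normal_vec)
  let ?G = "\<lambda>k. separated_noise X \<tau>\<^sub>0 \<beta>\<^sub>0 (1 / real (Suc k))"
  have "incseq ?G"
  proof (rule incseq_SucI)
    fix k
    have "1 / real (Suc (Suc k)) * x \<le> 1 / real (Suc k) * x" if "x \<ge> 0" for x
      using that by (intro mult_right_mono) (auto simp: field_simps)
    then show "?G k \<subseteq> ?G (Suc k)"
      unfolding separated_noise_def by (blast intro: order_le_less_trans zero_le_power2)
  qed
  then have "(\<lambda>k. prob (?G k)) \<longlonglongrightarrow> prob (\<Union>k. ?G k)"
    by (intro finite_Lim_measure_incseq) (auto intro: borel_open open_separated_noise)
  then have "eventually (\<lambda>k. 1 - \<delta> < prob (?G k)) sequentially"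
    using \<delta> unfolding prob_UN_separated_noise[OF id n] by (intro order_tendstoD) auto
  then obtain k where "1 - \<delta> < prob (?G k)" by (auto simp: eventually_sequentially)
  then show ?thesis by (intro exI[of _ "1 / real (Suc k)"]) auto
qed

section \<open>Coverage\<close>

text \<open>As an infimum of continuous functions the penalized loss is upper semicontinuous.\<close>

lemma borel_measurable_penalized_loss [measurable]:
  fixes X :: "real^'p^'n"
  assumes [measurable]: "f \<in> borel_measurable M" "g \<in> borel_measurable M"
  shows "(\<lambda>x. penalized_loss X lam (f x) (g x) \<tau>) \<in> borel_measurable M"
proof -
  let ?P = "\<lambda>p :: (real^'n) \<times> (real^'n). penalized_loss X lam (fst p) (snd p) \<tau>"
  let ?h = "\<lambda>b p. (norm (fst p - model_mult X \<tau> (fst b) - snd b *\<^sub>R snd p))\<^sup>2 + lam * real (card \<tau>)"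
  have P: "?P p = (INF b. ?h b p)" for p
    by (simp add: penalized_loss_def case_prod_beta)
  have "?P p < c \<longleftrightarrow> (\<exists>b. ?h b p < c)" for p c
    unfolding P by (subst cINF_less_iff) (auto intro!: bdd_belowI[of _ "lam * real (card \<tau>)"])
  \<comment> \<open>The union is uncountable, which open sets allow where measurable sets would
    not.\<close>
  then have "{p. ?P p < c} = (\<Union>b. {p. ?h b p < c})" for c by blast
  then have "open {p. ?P p < c}" for c
    by (auto intro!: open_UN open_Collect_less continuous_intros simp del: UN_simps)
  then have "?P \<in> borel_measurable borel"
    by (intro borel_measurableI_less) auto
  from measurable_compose[OF borel_measurable_Pair[OF assms] this] show ?thesis by simp
qed

text \<open>The event is expressed by comparisons of losses and quantifiers over finite types, so an
  arbitrary rule \<open>tie\<close> is allowed.\<close>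

lemma pred_tau_hat [measurable]:
  fixes X :: "real^'p^'n"
  assumes [measurable]: "f \<in> borel_measurable M" "g \<in> borel_measurable M"
  shows "Measurable.pred M (\<lambda>x. tau_hat tie X lam (f x) (g x) = \<tau>)"
proof -
  have "tau_hat tie X lam (f x) (g x) = \<tau> \<longleftrightarrow> (\<exists>S. tie S = \<tau> \<and> (\<forall>\<tau>'. \<tau>' \<in> S \<longleftrightarrow>
      (\<forall>\<tau>''. \<not> penalized_loss X lam (f x) (g x) \<tau>'' < penalized_loss X lam (f x) (g x) \<tau>')))" for x
  proof -
    have "(\<forall>\<tau>'. \<tau>' \<in> S \<longleftrightarrow>
        (\<forall>\<tau>''. \<not> penalized_loss X lam (f x) (g x) \<tau>'' < penalized_loss X lam (f x) (g x) \<tau>'))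
      \<longleftrightarrow> S = {\<tau>. is_arg_min (penalized_loss X lam (f x) (g x)) (\<lambda>_. True) \<tau>}" for S
      by (auto simp: is_arg_min_def)
    then show ?thesis by (auto simp: tau_hat_def)
  qed
  then show ?thesis by simp
qed

lemma borel_measurable_T_stat [measurable]:
  "(\<lambda>y. T_stat X \<Lambda> y \<beta> \<tau>) \<in> borel_measurable borel"
proof -
  have [measurable]: "(\<lambda>y. (y - v) \<bullet> (A *v (y - v))) \<in> borel_measurable borel"
    for v :: "real^'n" and A :: "real^'n^'n"
    by (intro borel_measurable_continuous_onI continuous_intros
        continuous_on_compose2[OF matrix_vector_mult_linear_continuous_on[of UNIV]]) auto
  show ?thesis unfolding T_stat_def Let_def by measurable
qed

lemma sets_B_set [measurable]: "B_set n \<alpha> \<Lambda> \<tau> \<in> sets borel"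
  by (simp add: B_set_def)

lemma borel_measurable_response [measurable]:
  "f \<in> borel_measurable M \<Longrightarrow> (\<lambda>x. response X \<tau>\<^sub>0 \<beta>\<^sub>0 \<sigma>\<^sub>0 (f x)) \<in> borel_measurable M"
  unfolding response_def by measurable

text \<open>Naming the selected model by a quantifier over a finite type leaves
  \<open>T_stat\<close> at a fixed model, where it is measurable in the response.\<close>

lemma coverage_event_eq:
  fixes X :: "real^'p^'n"
  shows "coverage_event M tie X \<tau>\<^sub>0 \<beta>\<^sub>0 \<sigma>\<^sub>0 U Us \<alpha> \<Lambda> lam d =
    {\<omega> \<in> space M. \<exists>b\<in>{..<d}. \<exists>\<tau>. tau_hat tie X lam (response X \<tau>\<^sub>0 \<beta>\<^sub>0 \<sigma>\<^sub>0 (U \<omega>)) (Us b \<omega>) = \<tau> \<and>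
      T_stat X \<Lambda> (response X \<tau>\<^sub>0 \<beta>\<^sub>0 \<sigma>\<^sub>0 (U \<omega>)) (restrict (full_coeff \<tau>\<^sub>0 \<beta>\<^sub>0) \<Lambda>) \<tau> \<in> B_set CARD('n) \<alpha> \<Lambda> \<tau>}"
  unfolding coverage_event_def conf_set_def cand_set_def Let_def by auto

lemma sets_coverage_event [measurable]:
  assumes [measurable]: "U \<in> borel_measurable M" "\<And>b. Us b \<in> borel_measurable M"
  shows "coverage_event M tie X \<tau>\<^sub>0 \<beta>\<^sub>0 \<sigma>\<^sub>0 U Us \<alpha> \<Lambda> lam d \<in> sets M"
  unfolding coverage_event_eq by measurable

section \<open>Conditioning on the repro samples\<close>

text \<open>The constant \<open>prob W\<close> satisfies the integral identity that characterizes
  the conditional expectation.\<close>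

lemma (in prob_space) real_cond_exp_indep_event:
  assumes F: "subalgebra M F" and W [measurable]: "W \<in> events"
    and indep: "\<And>A. A \<in> sets F \<Longrightarrow> prob (A \<inter> W) = prob A * prob W"
  shows "AE x in M. real_cond_exp M F (indicator W) x = prob W"
proof -
  interpret finite_measure_subalgebra M F by standard (rule F)
  show ?thesis
  proof (rule real_cond_exp_charact)
    fix A assume "A \<in> sets F"
    moreover from this have "A \<in> events" using F by (auto simp: subalgebra_def)
    ultimately show "(\<integral>x\<in>A. indicator W x \<partial>M) = (\<integral>x\<in>A. prob W \<partial>M)"
      using indep[of A] unfolding set_lebesgue_integral_def
      by (simp add: indicator_inter_arith[symmetric])
  qed (auto intro!: integrable_real_indicator simp: less_top[symmetric])
qed

lemma sets_sigma_U:
  "sets (sigma_U M Us d) =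
    {(\<lambda>\<omega>. \<lambda>b\<in>{..<d}. Us b \<omega>) -` B \<inter> space M | B. B \<in> sets (\<Pi>\<^sub>M b\<in>{..<d}. borel)}"
  unfolding sigma_U_def by (rule sets_vimage_algebra2) (auto simp: space_PiM)

lemma subalgebra_sigma_U:
  assumes [measurable]: "\<And>b. Us b \<in> borel_measurable M"
  shows "subalgebra M (sigma_U M Us d)"
proof -
  have "(\<lambda>\<omega>. \<lambda>b\<in>{..<d}. Us b \<omega>) \<in> measurable M (\<Pi>\<^sub>M b\<in>{..<d}. borel)" by measurable
  then show ?thesis
    unfolding subalgebra_def sets_sigma_U by (auto simp: sigma_U_def measurable_sets)
qed

lemma borel_measurable_sigma_U:
  assumes "b < d"
  shows "Us b \<in> borel_measurable (sigma_U M Us d)"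
proof -
  have "(\<lambda>\<omega>. \<lambda>b\<in>{..<d}. Us b \<omega>) \<in> measurable (sigma_U M Us d) (\<Pi>\<^sub>M b\<in>{..<d}. borel)"
    unfolding sigma_U_def by (rule measurable_vimage_algebra1) (auto simp: space_PiM)
  from measurable_compose[OF this measurable_component_singleton[of b]] assms
  show ?thesis by simp
qed

text \<open>The noise has index \<open>None\<close> and the repro samples have indices
  \<open>Some b\<close>; families over disjoint blocks of indices are independent.\<close>

lemma (in prob_space) sigma_U_indep:
  fixes U :: "'a \<Rightarrow> real^'n" and Us :: "nat \<Rightarrow> 'a \<Rightarrow> real^'n"
  assumes ind: "indep_vars (\<lambda>_. borel) (case_option U Us) UNIV"
    and A: "A \<in> sets (sigma_U M Us d)" and S: "S \<in> sets borel"
  shows "prob (A \<inter> (U -` S \<inter> space M)) = prob A * prob (U -` S \<inter> space M)"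
proof -
  let ?f = "\<lambda>\<omega>. \<lambda>b\<in>{..<d}. Us b \<omega>"
  obtain B where B: "B \<in> sets (\<Pi>\<^sub>M b\<in>{..<d}. borel)" "A = ?f -` B \<inter> space M"
    using A by (auto simp: sets_sigma_U)
  let ?D = "Some ` {..<d}" and ?Z = "case_option U Us"
  let ?g = "\<lambda>\<omega> :: nat option \<Rightarrow> real^'n. \<lambda>b\<in>{..<d}. \<omega> (Some b)"
  define XU where "XU = (\<lambda>\<omega>. \<omega> None) -` S \<inter> space (\<Pi>\<^sub>M i\<in>{None :: nat option}. borel :: (real^'n) measure)"
  define XD where "XD = ?g -` B \<inter> space (\<Pi>\<^sub>M i\<in>?D. borel :: (real^'n) measure)"
  have XU: "XU \<in> sets (\<Pi>\<^sub>M i\<in>{None :: nat option}. borel)"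
    unfolding XU_def using S by (intro measurable_sets[OF measurable_component_singleton]) auto
  have XD: "XD \<in> sets (\<Pi>\<^sub>M i\<in>?D. borel)"
    unfolding XD_def using B(1)
    by (intro measurable_sets[OF measurable_restrict]) (auto intro!: measurable_component_singleton)
  have 1: "(\<lambda>\<omega>. restrict (\<lambda>i. ?Z i \<omega>) {None}) -` XU \<inter> space M = U -` S \<inter> space M"
    by (auto simp: XU_def space_PiM)
  have "?g (restrict (\<lambda>i. ?Z i \<omega>) ?D) = ?f \<omega>" for \<omega> by (auto simp: fun_eq_iff)
  then have 2: "(\<lambda>\<omega>. restrict (\<lambda>i. ?Z i \<omega>) ?D) -` XD \<inter> space M = A"
    unfolding XD_def B(2) by (auto simp: space_PiM)
  have "indep_var (\<Pi>\<^sub>M i\<in>{None}. borel) (\<lambda>\<omega>. restrict (\<lambda>i. ?Z i \<omega>) {None})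
      (\<Pi>\<^sub>M i\<in>?D. borel) (\<lambda>\<omega>. restrict (\<lambda>i. ?Z i \<omega>) ?D)"
    by (rule indep_var_restrict[OF ind]) auto
  from indep_varD[OF this XU XD] have "prob ((U -` S \<inter> space M) \<inter> A) = prob (U -` S \<inter> space M) * prob A"
    unfolding 1 2 mem_Times_iff vimage_Times by (simp add: 1[symmetric] 2[symmetric] vimage_Times Int_assoc Int_left_commute comp_def)
  then show ?thesis by (simp add: Int_commute mult.commute)
qed

lemma (in prob_space) distributed_std_normal_vec:
  assumes "distributed M lborel U (\<lambda>u. ennreal (std_normal_vec_density u))"
  shows "U \<in> borel_measurable M" and "S \<in> sets borel \<Longrightarrow> prob (U -` S \<inter> space M) = measure std_normal_vec S"
proof -
  show U: "U \<in> borel_measurable M" using distributed_measurable[OF assms] by simp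
  show "prob (U -` S \<inter> space M) = measure std_normal_vec S" if "S \<in> sets borel"
  proof -
    have "distr M borel U = distr M lborel U" by (rule distr_cong) auto
    then have "distr M borel U = std_normal_vec"
      using distributed_distr_eq_density[OF assms] by (simp add: std_normal_vec_def)
    then show ?thesis using measure_distr[OF U that] by simp
  qed
qed

lemma (in prob_space) prob_all_avoid_le:
  assumes ind: "indep_vars (\<lambda>_. borel) (case_option U Us) UNIV"
    and S: "S \<in> sets borel" and q: "\<And>b. 1 - prob (Us b -` S \<inter> space M) \<le> q"
  shows "prob {\<omega> \<in> space M. \<forall>b<d. Us b \<omega> \<notin> S} \<le> q ^ d"
\<comment> \<open>An intersection over no samples would not be \<open>space M\<close>, so
  \<open>d = 0\<close> is settled separately by the bound 1.\<close>
proof (cases "d = 0")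
  case False
  have rv: "Us b \<in> borel_measurable M" for b
    using ind unfolding indep_vars_def by (auto dest!: spec[of _ "Some b"])
  have "{\<omega> \<in> space M. \<forall>b<d. Us b \<omega> \<notin> S} = (\<Inter>i\<in>Some ` {..<d}. case_option U Us i -` (- S) \<inter> space M)"
    using False by auto
  also have "prob \<dots> = (\<Prod>i\<in>Some ` {..<d}. prob (case_option U Us i -` (- S) \<inter> space M))"
    using False S by (intro indep_varsD[OF ind]) auto
  also have "\<dots> = (\<Prod>b<d. prob (Us b -` (- S) \<inter> space M))"
    by (subst prod.reindex) auto
  also have "\<dots> \<le> (\<Prod>b<d. q)"
  proof (rule prod_mono)
    fix b
    have "Us b -` (- S) \<inter> space M = space M - (Us b -` S \<inter> space M)" by auto
    then have "prob (Us b -` (- S) \<inter> space M) = 1 - prob (Us b -` S \<inter> space M)"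
      using measurable_sets[OF rv S] by (simp add: prob_compl)
    then show "0 \<le> prob (Us b -` (- S) \<inter> space M) \<and> prob (Us b -` (- S) \<inter> space M) \<le> q"
      using q[of b] by simp
  qed
  finally show ?thesis by simp
qed simp

section \<open>Compactness and covers of the diagonal\<close>

text \<open>Inner regularity of a finite Borel measure. A negative \<open>c\<close>, which arises
  from \<delta> > 1, is served by the empty set.\<close>

lemma ex_compact_std_normal_vec:
  fixes G :: "(real^'n) set"
  assumes "G \<in> sets borel" "c < measure std_normal_vec G"
  obtains K where "compact K" "K \<subseteq> G" "c < measure std_normal_vec K"
proof (cases "c < 0")
  case True
  then show ?thesis using that[of "{}"] by simp
next
  case False
  interpret prob_space "std_normal_vec :: (real^'n) measure" by (rule prob_space_std_normal_vec)
  have "ennreal c < emeasure std_normal_vec G"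
    using assms False by (simp add: emeasure_eq_measure ennreal_lessI)
  also have "emeasure std_normal_vec G = (SUP K \<in> {K. K \<subseteq> G \<and> compact K}. emeasure std_normal_vec K)"
    using assms(1) emeasure_space_1 by (intro inner_regular) auto
  finally obtain K where K: "K \<subseteq> G" "compact K" "ennreal c < emeasure std_normal_vec K"
    by (auto simp: less_SUP_iff)
  then have "c < measure std_normal_vec K"
    using False by (simp add: emeasure_eq_measure ennreal_less_iff)
  then show ?thesis using K that by blast
qed

text \<open>Around a diagonal point \<open>R\<close> contains an open rectangle
  \<open>A \<times> B\<close>, hence the square over \<open>A \<inter> B\<close>; compactness
  selects finitely many such sets.\<close>

lemma compact_diagonal_cover:
  fixes R :: "('a::topological_space \<times> 'a) set"
  assumes "compact K" "open R" "\<And>u. u \<in> K \<Longrightarrow> (u, u) \<in> R"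
  obtains \<V> where "finite \<V>" "K \<subseteq> \<Union>\<V>" "\<And>V. V \<in> \<V> \<Longrightarrow> open V \<and> V \<noteq> {} \<and> V \<times> V \<subseteq> R"
proof -
  define \<C> where "\<C> = {V. open V \<and> V \<noteq> {} \<and> V \<times> V \<subseteq> R}"
  have cover: "K \<subseteq> \<Union>\<C>"
  proof
    fix u assume "u \<in> K"
    then obtain A B where AB: "open A" "open B" "(u, u) \<in> A \<times> B" "A \<times> B \<subseteq> R"
      using open_prod_elim[OF assms(2) assms(3)] by metis
    then have "A \<inter> B \<in> \<C>" "u \<in> A \<inter> B" by (auto simp: \<C>_def)
    then show "u \<in> \<Union>\<C>" by blast
  qed
  have "open V" if "V \<in> \<C>" for V using that by (simp add: \<C>_def)
  from compactE[OF assms(1) cover this]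
  obtain \<V> where "\<V> \<subseteq> \<C>" "finite \<V>" "K \<subseteq> \<Union>\<V>" .
  show ?thesis
  proof (rule that)
    show "open V \<and> V \<noteq> {} \<and> V \<times> V \<subseteq> R" if "V \<in> \<V>" for V
      using that \<open>\<V> \<subseteq> \<C>\<close> unfolding \<C>_def by blast
  qed fact+
qed

section \<open>Coverage for a fixed penalty\<close>

lemma repro_coverage:
  fixes X :: "real^'p^'n" and \<tau>\<^sub>0 \<Lambda> :: "'p set" and \<beta>\<^sub>0 :: "'p \<Rightarrow> real"
    and \<sigma>\<^sub>0 \<alpha> \<delta> \<kappa> lam :: real
    and M :: "'a measure" and U :: "'a \<Rightarrow> real^'n" and Us :: "nat \<Rightarrow> 'a \<Rightarrow> real^'n"
    and tie :: "'p set set \<Rightarrow> 'p set"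
  defines "E \<equiv> coverage_event M tie X \<tau>\<^sub>0 \<beta>\<^sub>0 \<sigma>\<^sub>0 U Us \<alpha> \<Lambda> lam"
  assumes "prob_space M"
    and ind: "prob_space.indep_vars M (\<lambda>_. borel) (case_option U Us) UNIV"
    and U: "distributed M lborel U (\<lambda>u. ennreal (std_normal_vec_density u))"
    and Us: "\<And>b. distributed M lborel (Us b) (\<lambda>u. ennreal (std_normal_vec_density u))"
    and \<sigma>: "\<sigma>\<^sub>0 > 0" and id: "identifiable X \<tau>\<^sub>0 \<beta>\<^sub>0"
    and tie: "\<And>A. A \<noteq> {} \<Longrightarrow> tie A \<in> A"
    and \<alpha>: "0 < \<alpha>" "\<alpha> < 1" and n: "card \<tau>\<^sub>0 < CARD('n)"
    and \<kappa>: "measure std_normal_vec (separated_noise X \<tau>\<^sub>0 \<beta>\<^sub>0 \<kappa>) > 1 - \<delta>"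
    and lam: "lam > 0" "lam * real (card \<tau>\<^sub>0) < \<kappa>"
  shows "\<exists>c\<^sub>1>0.
      (\<exists>f \<in> o(\<lambda>d. exp (- c\<^sub>1 * real d)). \<forall>d. measure M (E d) \<ge> \<alpha> - \<delta> - f d) \<and>
      (\<exists>R. (\<forall>d. R d \<in> borel_measurable (sigma_U M Us d)) \<and>
           small_op M R (\<lambda>d. exp (- c\<^sub>1 * real d)) \<and>
           (\<forall>d. AE \<omega> in M.
              real_cond_exp M (sigma_U M Us d) (indicator (E d)) \<omega> \<ge> \<alpha> - \<delta> - R d \<omega>))"
proof -
  interpret prob_space M by fact
  note [measurable] = distributed_std_normal_vec(1)[OF U] distributed_std_normal_vec(1)[OF Us]
  note law_U = distributed_std_normal_vec(2)[OF U] and law_Us = distributed_std_normal_vec(2)[OF Us]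
  have ind: "indep_vars (\<lambda>_. borel) (case_option U Us) UNIV" by (fact ind)
  have E_meas [measurable]: "E d \<in> events" for d unfolding E_def by measurable
  let ?R = "recovery_region X \<tau>\<^sub>0 \<beta>\<^sub>0 \<sigma>\<^sub>0 lam \<kappa>"
  obtain K where K: "compact K" "K \<subseteq> separated_noise X \<tau>\<^sub>0 \<beta>\<^sub>0 \<kappa>" "1 - \<delta> < measure std_normal_vec K"
    using ex_compact_std_normal_vec[OF borel_open[OF open_separated_noise] \<kappa>] by blast
  have Km [measurable]: "K \<in> sets borel" using K(1) by (simp add: borel_compact)
  have "(u, u) \<in> ?R" if "u \<in> K" for u
    using recovery_region_diagonal[OF _ lam] K(2) that by blast
  then obtain \<V> where \<V>: "finite \<V>" "K \<subseteq> \<Union>\<V>" "\<And>V. V \<in> \<V> \<Longrightarrow> open V \<and> V \<noteq> {} \<and> V \<times> V \<subseteq> ?R"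
    using compact_diagonal_cover[OF K(1) open_recovery_region] by metis
  define B where "B = {u. T_stat X \<Lambda> (response X \<tau>\<^sub>0 \<beta>\<^sub>0 \<sigma>\<^sub>0 u) (restrict (full_coeff \<tau>\<^sub>0 \<beta>\<^sub>0) \<Lambda>) \<tau>\<^sub>0
        \<in> B_set CARD('n) \<alpha> \<Lambda> \<tau>\<^sub>0}"
  have Bm [measurable]: "B \<in> sets borel" unfolding B_def by measurable
  \<comment> \<open>\<open>W\<close> is determined by the noise alone and \<open>N d\<close> below
    by the repro samples alone; this separation is what makes the conditional bound
    possible.\<close>
  define W where "W = U -` (B \<inter> K) \<inter> space M"
  have Wm [measurable]: "W \<in> events" unfolding W_def by measurable
  define N where "N d = {\<omega> \<in> space M. \<exists>V\<in>\<V>. \<forall>b\<in>{..<d}. Us b \<omega> \<notin> V}" for d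
  have N_sigma: "N d \<in> sets (sigma_U M Us d)" for d
  proof -
    have "{\<omega> \<in> space (sigma_U M Us d). \<forall>b\<in>{..<d}. Us b \<omega> \<notin> V} \<in> sets (sigma_U M Us d)" if "V \<in> \<V>" for V
    proof (rule sets.sets_Collect_finite_All)
      fix b assume "b \<in> {..<d}"
      then have [measurable]: "Us b \<in> borel_measurable (sigma_U M Us d)"
        by (intro borel_measurable_sigma_U) simp
      have [measurable]: "V \<in> sets borel" using \<V>(3)[OF that] by simp
      show "{\<omega> \<in> space (sigma_U M Us d). Us b \<omega> \<notin> V} \<in> sets (sigma_U M Us d)" by measurable
    qed auto
    then have "{\<omega> \<in> space (sigma_U M Us d). \<exists>V\<in>\<V>. \<forall>b\<in>{..<d}. Us b \<omega> \<notin> V} \<in> sets (sigma_U M Us d)"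
      using \<V>(1) by (intro sets.sets_Collect_finite_Ex) auto
    then show ?thesis by (simp add: N_def sigma_U_def)
  qed
  have sub: "subalgebra M (sigma_U M Us d)" for d by (rule subalgebra_sigma_U) measurable
  have N_meas [measurable]: "N d \<in> events" for d
    using N_sigma sub by (auto simp: subalgebra_def)
  \<comment> \<open>On \<open>W\<close> outside \<open>N d\<close> the noise and some repro sample
    share a set \<open>V\<close>, so the true model is a candidate, and it covers. Integrating and
    conditioning this inequality give the two claims.\<close>
  have W_le: "indicator W \<omega> - indicator (N d) \<omega> \<le> (indicator (E d) \<omega> :: real)" if \<omega>: "\<omega> \<in> space M" for \<omega> d
  proof (cases "\<omega> \<in> W \<and> \<omega> \<notin> N d")
    case True
    then obtain V where V: "V \<in> \<V>" "U \<omega> \<in> V" using \<V>(2) by (auto simp: W_def)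
    then obtain b where b: "b < d" "Us b \<omega> \<in> V" using True \<omega> by (auto simp: N_def)
    have "(U \<omega>, Us b \<omega>) \<in> ?R" using \<V>(3)[OF V(1)] V(2) b(2) by auto
    then have "tau_hat tie X lam (response X \<tau>\<^sub>0 \<beta>\<^sub>0 \<sigma>\<^sub>0 (U \<omega>)) (Us b \<omega>) = \<tau>\<^sub>0"
      using lam(1) tie by (rule tau_hat_recovery)
    then have "\<omega> \<in> E d"
      using True \<omega> b(1) unfolding E_def coverage_event_eq W_def B_def by (auto intro!: bexI[of _ b])
    then show ?thesis using True by simp
  qed (auto simp: indicator_def)
  have "\<alpha> \<le> measure std_normal_vec B"
    unfolding B_def by (rule T_stat_coverage[OF id \<sigma> \<alpha> n])
  then have "prob (U -` B \<inter> space M) \<ge> \<alpha>" by (simp only: law_U[OF Bm])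
  moreover have "prob (U -` K \<inter> space M) > 1 - \<delta>" using K(3) by (simp add: law_U[OF Km])
  moreover have "W = (U -` B \<inter> space M) \<inter> (U -` K \<inter> space M)" by (auto simp: W_def)
  \<comment> \<open>The Bonferroni inequality for the two noise events.\<close>
  then have "prob (U -` B \<inter> space M) + prob (U -` K \<inter> space M) - 1 \<le> prob W"
    using finite_measure_Union'[of "U -` B \<inter> space M" "U -` K \<inter> space M"]
      finite_measure_Diff'[of "U -` K \<inter> space M" "U -` B \<inter> space M"]
      prob_le_1[of "U -` B \<inter> space M \<union> U -` K \<inter> space M"]
    by (simp add: Int_commute)
  ultimately have W: "\<alpha> - \<delta> \<le> prob W" by linarith
  \<comment> \<open>The element 1/2 keeps the set nonempty even if \<open>\<V>\<close> is empty, and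
    \<open>q\<close> positive, so that \<open>ln q\<close> below is meaningful.\<close>
  define q where "q = Max (insert (1/2) ((\<lambda>V. 1 - measure std_normal_vec V) ` \<V>))"
  have q_ge: "1 - measure std_normal_vec V \<le> q" if "V \<in> \<V>" for V
    unfolding q_def using \<V>(1) that by (intro Max_ge) auto
  have q: "0 < q" "q < 1"
  proof -
    have "1/2 \<le> q" unfolding q_def using \<V>(1) by (intro Max_ge) auto
    then show "0 < q" by simp
    show "q < 1" unfolding q_def using \<V> std_normal_vec_open_pos by (subst Max_less_iff) auto
  qed
  have N_le: "prob (N d) \<le> real (card \<V>) * q ^ d" for d
  proof -
    have "N d = (\<Union>V\<in>\<V>. {\<omega> \<in> space M. \<forall>b<d. Us b \<omega> \<notin> V})" by (auto simp: N_def)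
    also have "prob \<dots> \<le> (\<Sum>V\<in>\<V>. prob {\<omega> \<in> space M. \<forall>b<d. Us b \<omega> \<notin> V})"
    proof (rule finite_measure_subadditive_finite[OF \<V>(1)])
      have "{\<omega> \<in> space M. \<forall>b<d. Us b \<omega> \<notin> V} \<in> events" if "V \<in> \<V>" for V
      proof -
        have [measurable]: "V \<in> sets borel" using \<V>(3)[OF that] by simp
        show ?thesis by measurable
      qed
      then show "(\<lambda>V. {\<omega> \<in> space M. \<forall>b<d. Us b \<omega> \<notin> V}) ` \<V> \<subseteq> events"
        by (rule image_subsetI)
    qed
    also have "\<dots> \<le> (\<Sum>V\<in>\<V>. q ^ d)"
    proof (rule sum_mono)
      fix V assume V: "V \<in> \<V>"
      then have "V \<in> sets borel" using \<V>(3) by auto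
      then show "prob {\<omega> \<in> space M. \<forall>b<d. Us b \<omega> \<notin> V} \<le> q ^ d"
        using q_ge[OF V] by (intro prob_all_avoid_le[OF ind]) (auto simp: law_Us)
    qed
    finally show ?thesis by simp
  qed
  \<comment> \<open>Half the decay rate of \<open>q ^ d\<close>: dividing by
    \<open>exp (- c * real d)\<close> leaves \<open>exp (- c) ^ d\<close>, which still tends to
    0.\<close>
  define c where "c = - ln q / 2"
  have c: "c > 0" using q by (simp add: c_def)
  have qc: "q = exp (- c) * exp (- c)" using q by (simp add: c_def exp_add[symmetric])
  let ?f = "\<lambda>d. real (card \<V>) * q ^ d"
  have f: "?f \<in> o(\<lambda>d. exp (- c * real d))"
  proof (rule smalloI_tendsto)
    have "?f d / exp (- c * real d) = real (card \<V>) * exp (- c) ^ d" for d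
      by (simp add: qc power_mult_distrib exp_of_nat_mult[symmetric] mult.commute)
    moreover have "(\<lambda>d. real (card \<V>) * exp (- c) ^ d) \<longlonglongrightarrow> 0"
      using c by (intro tendsto_mult_right_zero LIMSEQ_realpow_zero) auto
    ultimately show "(\<lambda>d. ?f d / exp (- c * real d)) \<longlonglongrightarrow> 0" by simp
  qed simp
  have N_0: "(\<lambda>d. prob (N d)) \<longlonglongrightarrow> 0"
  proof (rule tendsto_sandwich[of "\<lambda>_. 0" _ _ ?f])
    show "?f \<longlonglongrightarrow> 0" using q by (intro tendsto_mult_right_zero LIMSEQ_realpow_zero) auto
  qed (use N_le in auto)
  have int: "integrable M (indicator A :: 'a \<Rightarrow> real)" if "A \<in> events" for A
    using that by (auto intro!: integrable_real_indicator simp: less_top[symmetric])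
  have int_diff: "integrable M (\<lambda>\<omega>. indicator W \<omega> - indicator (N d) \<omega> :: real)" for d
    by (intro Bochner_Integration.integrable_diff int) measurable
  have prob_E: "\<alpha> - \<delta> - ?f d \<le> prob (E d)" for d
  proof -
    have "prob W - prob (N d) = (\<integral>\<omega>. indicator W \<omega> - indicator (N d) \<omega> \<partial>M)"
      by (subst Bochner_Integration.integral_diff) (simp_all add: int)
    also have "\<dots> \<le> (\<integral>\<omega>. indicator (E d) \<omega> \<partial>M)"
      using W_le by (intro integral_mono int_diff) (simp_all add: int)
    also have "\<dots> = prob (E d)" by simp
    finally show ?thesis using W N_le[of d] by linarith
  qed
  let ?r = "\<lambda>d \<omega>. indicator (N d) \<omega> :: real"
  have r_small: "small_op M ?r (\<lambda>d. exp (- c * real d))"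
    unfolding small_op_def
  proof (intro allI impI)
    fix \<epsilon> :: real assume \<epsilon>: "\<epsilon> > 0"
    \<comment> \<open>The ratio is nonzero only on \<open>N d\<close>, so the probability of
      exceeding \<epsilon> is at most that of \<open>N d\<close>, whatever the scaling.\<close>
    have "prob {\<omega> \<in> space M. \<epsilon> < \<bar>?r d \<omega> / exp (- c * real d)\<bar>} \<le> prob (N d)" for d
      using \<epsilon> by (intro finite_measure_mono) (auto simp: indicator_def split: if_splits)
    then show "(\<lambda>d. prob {\<omega> \<in> space M. \<epsilon> < \<bar>?r d \<omega> / exp (- c * real d)\<bar>}) \<longlonglongrightarrow> 0"
      by (intro tendsto_sandwich[OF _ _ tendsto_const N_0]) auto
  qed
  have cond: "AE \<omega> in M. \<alpha> - \<delta> - ?r d \<omega> \<le> real_cond_exp M (sigma_U M Us d) (indicator (E d)) \<omega>" for d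
  proof -
    interpret finite_measure_subalgebra M "sigma_U M Us d" by standard (rule sub)
    let ?ce = "real_cond_exp M (sigma_U M Us d)"
    \<comment> \<open>\<open>W\<close> is independent of the repro samples and \<open>N d\<close> is
      determined by them: one conditional expectation is constant, the other is the indicator
      itself.\<close>
    have "AE \<omega> in M. ?ce (indicator W) \<omega> = prob W"
    proof (rule real_cond_exp_indep_event[OF sub Wm])
      fix A assume "A \<in> sets (sigma_U M Us d)"
      then show "prob (A \<inter> W) = prob A * prob W"
        unfolding W_def by (rule sigma_U_indep[OF ind]) measurable
    qed
    moreover have "AE \<omega> in M. ?ce (?r d) \<omega> = ?r d \<omega>"
      by (rule real_cond_exp_F_meas) (auto intro: int borel_measurable_indicator N_sigma)
    moreover have "AE \<omega> in M. ?ce (\<lambda>\<omega>. indicator W \<omega> - ?r d \<omega>) \<omega> = ?ce (indicator W) \<omega> - ?ce (?r d) \<omega>"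
      by (rule real_cond_exp_diff) (auto intro: int)
    moreover have "AE \<omega> in M. ?ce (\<lambda>\<omega>. indicator W \<omega> - ?r d \<omega>) \<omega> \<le> ?ce (indicator (E d)) \<omega>"
      using W_le by (intro real_cond_exp_mono int_diff int) auto
    ultimately show ?thesis
      by eventually_elim (use W in linarith)
  qed
  show ?thesis
    using c f prob_E r_small cond N_sigma
    by (intro exI[of _ c] conjI bexI[of _ ?f] exI[of _ ?r]) (auto intro: borel_measurable_indicator)
qed

section \<open>Choice of the constant \<gamma>\<close>

theorem theorem10:
  fixes X :: "real^'p^'n" and \<tau>\<^sub>0 \<Lambda> :: "'p set" and \<beta>\<^sub>0 :: "'p \<Rightarrow> real"
    and \<sigma>\<^sub>0 \<alpha> \<delta> :: real
    and M :: "'a measure" and U :: "'a \<Rightarrow> real^'n" and Us :: "nat \<Rightarrow> 'a \<Rightarrow> real^'n"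
    and tie :: "'p set set \<Rightarrow> 'p set"
  assumes "prob_space M"
    and "prob_space.indep_vars M (\<lambda>_. borel) (case_option U Us) UNIV"
    and "distributed M lborel U (\<lambda>u. ennreal (std_normal_vec_density u))"
    and "\<And>b. distributed M lborel (Us b) (\<lambda>u. ennreal (std_normal_vec_density u))"
    and "\<tau>\<^sub>0 \<noteq> {}" and "\<sigma>\<^sub>0 > 0"
    and "identifiable X \<tau>\<^sub>0 \<beta>\<^sub>0"
    and "\<And>A. A \<noteq> {} \<Longrightarrow> tie A \<in> A"
    and "0 < \<alpha>" and "\<alpha> < 1"
    and "int CARD('n) - int (card \<tau>\<^sub>0) > 4"
    and "\<delta> > 0"
  shows "\<exists>\<gamma>. 0 < \<gamma> \<and> \<gamma> < 1 \<and>
    (let n = real CARD('n); p = real CARD('p);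
         lo = 4 * n * \<gamma> powr (1/2) * (2 + 2 * (real (card \<tau>\<^sub>0) + 1) * (ln (p / 2) / n)) * \<sigma>\<^sub>0\<^sup>2;
         hi = n * \<gamma> powr (1/4) / 6 * C_min X \<tau>\<^sub>0 \<beta>\<^sub>0
     in lo \<le> hi \<and>
        (\<forall>lam\<in>{lo..hi}.
          let E = coverage_event M tie X \<tau>\<^sub>0 \<beta>\<^sub>0 \<sigma>\<^sub>0 U Us \<alpha> \<Lambda> lam
          in \<exists>c\<^sub>1>0.
            (\<exists>f \<in> o(\<lambda>d. exp (- c\<^sub>1 * real d)).
               \<forall>d. measure M (E d) \<ge> \<alpha> - \<delta> - f d) \<and>
            (\<exists>R. (\<forall>d. R d \<in> borel_measurable (sigma_U M Us d)) \<and>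
                 small_op M R (\<lambda>d. exp (- c\<^sub>1 * real d)) \<and>
                 (\<forall>d. AE \<omega> in M.
                    real_cond_exp M (sigma_U M Us d) (indicator (E d)) \<omega> \<ge> \<alpha> - \<delta> - R d \<omega>))))"
proof -
  interpret prob_space M by fact
  let ?k = "real (card \<tau>\<^sub>0)" and ?n = "real CARD('n)" and ?p = "real CARD('p)"
  let ?C = "C_min X \<tau>\<^sub>0 \<beta>\<^sub>0"
  define a where "a = 2 + 2 * (?k + 1) * (ln (?p / 2) / ?n)"
  have n: "card \<tau>\<^sub>0 + 4 < CARD('n)" using assms(11) by simp
  have k: "1 \<le> ?k" using assms(5) by (simp add: card_gt_0_iff Suc_le_eq)
  \<comment> \<open>For \<open>CARD('p) = 1\<close> the logarithm is negative; then
    \<open>card \<tau>\<^sub>0 = 1\<close>, and \<open>n\<close> is large enough to keep the bracket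
    positive.\<close>
  have a: "a > 0"
  proof (cases "CARD('p) = 1")
    case True
    have "card \<tau>\<^sub>0 \<le> CARD('p)" by (rule card_mono) auto
    then have k1: "?k = 1" using True k by simp
    have "4 * ln 2 < 2 * ?n" using n ln_2_less_1 k1 by linarith
    then show ?thesis unfolding a_def k1 using True n by (simp add: ln_div field_simps)
  next
    case False
    moreover have "0 < CARD('p)" by simp
    ultimately have "2 \<le> CARD('p)" by linarith
    then have "0 \<le> ln (?p / 2)" by simp
    then have "0 \<le> 2 * (?k + 1) * (ln (?p / 2) / ?n)" by (intro mult_nonneg_nonneg divide_nonneg_nonneg) auto
    then show ?thesis by (simp add: a_def)
  qed
  have C: "?C > 0" by (rule C_min_pos[OF assms(7,5)])
  have n0: "?n > 0" by simp
  obtain \<kappa> where \<kappa>: "\<kappa> > 0" "measure std_normal_vec (separated_noise X \<tau>\<^sub>0 \<beta>\<^sub>0 \<kappa>) > 1 - \<delta>"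
    using ex_separated_noise_prob[OF assms(7) _ assms(12)] n by auto
  \<comment> \<open>\<open>g\<close> is the fourth root of \<open>\<gamma>\<close>. The entry 1/2
    keeps it below 1, the next one gives \<open>?lo \<le> ?hi\<close>, and the last one gives
    \<open>?hi * ?k \<le> \<kappa> / 2\<close>, hence strictly below
    \<open>\<kappa>\<close>.\<close>
  define g where "g = min (1/2) (min (?C / (24 * a * \<sigma>\<^sub>0\<^sup>2)) (3 * \<kappa> / (?n * ?C * ?k)))"
  have g: "0 < g" "g < 1" "g \<le> ?C / (24 * a * \<sigma>\<^sub>0\<^sup>2)" "g \<le> 3 * \<kappa> / (?n * ?C * ?k)"
    using a C \<kappa>(1) k assms(6) by (auto simp: g_def)
  define \<gamma> where "\<gamma> = g powr 4"
  have \<gamma>: "0 < \<gamma>" "\<gamma> < 1" "\<gamma> powr (1/2) = g\<^sup>2" "\<gamma> powr (1/4) = g"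
  proof -
    show "0 < \<gamma>" using g by (simp add: \<gamma>_def)
    have "\<gamma> = g ^ 4" using g by (simp add: \<gamma>_def powr_numeral)
    then show "\<gamma> < 1" using g by (simp add: power_less_one_iff)
    have "\<gamma> powr (1/2) = g powr 2" "\<gamma> powr (1/4) = g powr 1"
      unfolding \<gamma>_def powr_powr by simp_all
    then show "\<gamma> powr (1/2) = g\<^sup>2" "\<gamma> powr (1/4) = g"
      using g by (simp_all add: powr_numeral)
  qed
  let ?lo = "4 * ?n * \<gamma> powr (1/2) * a * \<sigma>\<^sub>0\<^sup>2" and ?hi = "?n * \<gamma> powr (1/4) / 6 * ?C"
  \<comment> \<open>A positive left end makes every penalty in the interval positive.\<close>
  have lo_pos: "0 < ?lo" using a g(1) assms(6) unfolding \<gamma>(3) by simp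
  have "g * (24 * a * \<sigma>\<^sub>0\<^sup>2) \<le> ?C"
    using g(3) a assms(6) by (simp add: pos_le_divide_eq)
  then have "?n * g / 6 * (g * (24 * a * \<sigma>\<^sub>0\<^sup>2)) \<le> ?n * g / 6 * ?C"
    using g(1) by (intro mult_left_mono) auto
  then have lo_hi: "?lo \<le> ?hi"
    unfolding \<gamma> by (simp add: power2_eq_square mult_ac)
  have "g * (?n * ?C * ?k) \<le> 3 * \<kappa>"
    using g(4) C k n0 by (simp add: pos_le_divide_eq)
  then have hi: "?hi * ?k < \<kappa>"
    using \<kappa>(1) unfolding \<gamma> by (simp add: mult_ac)
  show ?thesis
    unfolding Let_def
  proof (rule exI[of _ \<gamma>], intro conjI ballI)
    fix lam assume "lam \<in> {4 * ?n * \<gamma> powr (1/2) * (2 + 2 * (?k + 1) * (ln (?p / 2) / ?n)) * \<sigma>\<^sub>0\<^sup>2 .. ?hi}"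
    then have lam: "?lo \<le> lam" "lam \<le> ?hi" by (auto simp: a_def)
    have "lam * ?k < \<kappa>" using mult_right_mono[OF lam(2), of ?k] hi by linarith
    moreover have "lam > 0" using lam(1) lo_pos by linarith
    ultimately show "\<exists>c\<^sub>1>0.
        (\<exists>f \<in> o(\<lambda>d. exp (- c\<^sub>1 * real d)).
           \<forall>d. measure M (coverage_event M tie X \<tau>\<^sub>0 \<beta>\<^sub>0 \<sigma>\<^sub>0 U Us \<alpha> \<Lambda> lam d) \<ge> \<alpha> - \<delta> - f d) \<and>
        (\<exists>R. (\<forall>d. R d \<in> borel_measurable (sigma_U M Us d)) \<and>
             small_op M R (\<lambda>d. exp (- c\<^sub>1 * real d)) \<and>
             (\<forall>d. AE \<omega> in M.
                real_cond_exp M (sigma_U M Us d)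
                  (indicator (coverage_event M tie X \<tau>\<^sub>0 \<beta>\<^sub>0 \<sigma>\<^sub>0 U Us \<alpha> \<Lambda> lam d)) \<omega> \<ge> \<alpha> - \<delta> - R d \<omega>))"
      using n by (intro repro_coverage[OF assms(1-4,6-10) _ \<kappa>(2)]) auto
  qed (use \<gamma> lo_hi in \<open>auto simp: a_def\<close>)
qed

end
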